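(* Suppose that the standing assumptions (SA1), (SA2), (SA3) and Assumption 2 of the context hold. Then, for any $i\in\mathbb{Z}_{\ge0}$ and $x\in\mathbb{R}^{n_x}$, $$(V_r^i-V^\star)(x)\le(V_r^0-V^\star)(\phi(i,x,h^\star)),$$ where $h^\star\in H^\star$ is a selection of the optimal input map. Moreover, for any $i\in\mathbb{Z}_{\ge0}$ and $x\in\mathbb{R}^{n_x}$, $$V_r^i(x)-V^\star(x)\le\widetilde\alpha(\beta(\sigma(x),i)),$$ where $\beta\in\mathcal{KL}$ is $\beta(s,k)=\underline\alpha_Y^{-1}\circ(\mathbb{I}-\widetilde\alpha_Y)^{(k)}\circ\overline\alpha_Y(s)$ and $\widetilde\alpha(s)=\max_{\hat s\in[0,s]}\widehat\alpha(\hat s)$ is a non-decreasing and positive definite function, with $\underline\alpha_Y,\overline\alpha_Y,\widetilde\alpha_Y,\widehat\alpha$ defined in the context.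
   Context: Notation. $\mathbb{R}_{\ge0}=[0,\infty)$, $\mathbb{Z}_{\ge0}=\{0,1,\dots\}$; $\mathbb{B}$ is the closed unit ball of $\mathbb{R}^{n_x}$. $\mathbb{I}$ is the identity on $\mathbb{R}_{\ge0}$; $g^{(k)}$ is the $k$-fold composition of $g$ with itself, $g^{(0)}=\mathbb{I}$. $\mathcal{K}_\infty$: continuous, strictly increasing, unbounded functions $\mathbb{R}_{\ge0}\to\mathbb{R}_{\ge0}$ that are zero at zero. $\mathcal{KL}$: functions $\beta(s,k)\ge0$ of $s\in\mathbb{R}_{\ge0}$ and $k$ (here $k\in\mathbb{Z}_{\ge0}$), nondecreasing in $s$ with $\lim_{s\to0^+}\beta(s,k)=0$ for each $k$, and nonincreasing in $k$ with $\lim_{k\to\infty}\beta(s,k)=0$ for each $s$. A function on $\mathbb{R}_{\ge0}$ is positive definite if it is zero at zero and positive elsewhere. A selection of a set-valued map $S$ is a single-valued $s$ with $s(x)\in S(x)$ for all $x\in\operatorname{dom}S$; one writes $s\in S$. A set-valued map $S$ is outer semicontinuous if $x_n\to x$, $u_n\in S(x_n)$, $u_n\to u$ imply $u\in S(x)$. For a set $A$, $S(A)=\bigcup_{a\in A}S(a)$. A function $\ell(x,u)$ is level-bounded in $u$, locally uniform in $x$, if for each $x\in\mathbb{R}^{n_x}$ and $\alpha\in\mathbb{R}$ there are a neighborhood $\mathcal{S}$ of $x$ and a bounded set $B\subset\mathbb{R}^{n_u}$ such that $\{u:\ell(z,u)\le\alpha\}\subset B$ for all $z\in\mathcal{S}$.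 Plant and cost. $x(k+1)=f(x(k),u(k))$ with $x\in\mathbb{R}^{n_x}$, $u\in\mathcal{U}(x)\subseteq\mathbb{R}^{n_u}$, $\mathcal{U}(x)\neq\emptyset$ for every $x$; $\mathcal{W}=\{(x,u):u\in\mathcal{U}(x)\}$. The stage cost is $\ell:\mathbb{R}^{n_x}\times\mathbb{R}^{n_u}\to\mathbb{R}_{\ge0}$. For an admissible infinite input sequence $\mathbf{u}$, $J(x,\mathbf{u})=\sum_{k=0}^\infty\ell(x(k),u(k))$ along the resulting solution from $x(0)=x$. For a policy $h\in\mathcal{U}$, $\phi(k,x,h)$ is the closed-loop solution from $x$ and $J(x,h)=\sum_{k=0}^\infty\ell(\phi(k,x,h),h(\phi(k,x,h)))$. $V^\star(x)=\min_{\mathbf{u}}J(x,\mathbf{u})$ and $H^\star(x)=\operatorname{argmin}_{u\in\mathcal{U}(x)}\{\ell(x,u)+V^\star(f(x,u))\}$. Standing assumptions. $\sigma:\mathbb{R}^{n_x}\to\mathbb{R}_{\ge0}$ is continuous, and $h^0\in\mathcal{U}$ is a given initial policy. (SA1) For every $x$ there is an admissible input sequence $\mathbf{u}^\star(x)$ attaining the minimum $V^\star(x)=J(x,\mathbf{u}^\star(x))<+\infty$. (SA2) There exist a continuous $W:\mathbb{R}^{n_x}\to\mathbb{R}_{\ge0}$, $\alpha_W,\chi_W\in\mathcal{K}_\infty$ and $\overline\alpha_W:\mathbb{R}_{\ge0}\to\mathbb{R}_{\ge0}$ continuous, nondecreasing and zero at zero such that for all $(x,u)\in\mathcal{W}$: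 $W(x)\le\overline\alpha_W(\sigma(x))$ and $W(f(x,u))-W(x)\le-\alpha_W(\sigma(x))+\chi_W(\ell(x,u))$. (SA3) There exists $\overline\alpha_V\in\mathcal{K}_\infty$ with $J(x,h^0)\le\overline\alpha_V(\sigma(x))$ for all $x\in\mathbb{R}^{n_x}$. Algorithm PI$^+$. $V_r^0:=J(\cdot,h^0)$, $H^0:=H_r^0:=H_r^{\star,0}:=\{h^0\}$. For $i\in\mathbb{Z}_{\ge0}$ and all $x$: $H^{i+1}(x):=\operatorname{argmin}_{u\in\mathcal{U}(x)}\{\ell(x,u)+V_r^i(f(x,u))\}$; $H_r^{i+1}(x):=\bigcap_{\delta>0}\overline{H^{i+1}(x+\delta\mathbb{B})}$; $V_r^{i+1}(x):=\min_{h\in H_r^{i+1}}J(x,h)$ (minimum over selections $h$ of $H_r^{i+1}$); $H_r^{\star,i+1}(x):=\operatorname{argmin}_{u\in H_r^{i+1}(x)}\{\ell(x,u)+V_r^{i+1}(f(x,u))\}$. Assumption 2. (i) $f$ and $\ell$ are continuous on $\mathbb{R}^{n_x}\times\mathbb{R}^{n_u}$. (ii) $\ell$ is level-bounded in $u$, locally uniform in $x$. (iii) $\mathcal{U}$ is outer semicontinuous on $\mathbb{R}^{n_x}$. (iv) $V_r^0=J(\cdot,h^0)$ is lower semicontinuous on $\mathbb{R}^{n_x}$. (v) For all $\Delta>0$, $\{x:\sigma(x)\le\Delta\}$ is compact. Functions. General case: $q_V(s)=2\chi_W(2s)$; $q_W=\tfrac12[\chi_W+(\overline\alpha_W+\mathbb{I})\circ\alpha_W^{-1}(2\chi_W)]^{-1}$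 (one half of the inverse function); $\rho_V(s)=\int_0^sq_V(\tau)d\tau$; $\rho_W(s)=\int_0^sq_W(\tau)d\tau$; $\alpha_Y=q_W(\tfrac14\alpha_W)\,\tfrac14\alpha_W$; $\overline\alpha_Y=\rho_V\circ\overline\alpha_V+\rho_W\circ\overline\alpha_W$; $\underline\alpha_Y=\min\{\rho_V\circ\chi_W^{-1}(\tfrac12\alpha_W),\rho_W(\tfrac12\alpha_W)\}$; $\widetilde\alpha_Y=\alpha_Y\circ\overline\alpha_Y^{-1}$; $\widehat\alpha=\overline\alpha_V-\chi_W^{-1}(\max\{0,\alpha_W-\overline\alpha_W\})$. When $\chi_W\le\mathbb{I}$, instead: $\alpha_Y=\alpha_W$, $\overline\alpha_Y=\overline\alpha_V+\overline\alpha_W$, $\underline\alpha_Y=\alpha_W$, $\widetilde\alpha_Y=\alpha_Y\circ\overline\alpha_Y^{-1}$, $\widehat\alpha=\min\{\overline\alpha_V,\overline\alpha_Y-\underline\alpha_Y\}$. When there exist $c_W,a_W,\overline a_V>0$ and $\overline a_W\ge0$ with $\chi_W(s)\le c_Ws$, $\alpha_W(s)\ge a_Ws$, $\overline\alpha_V(s)\le\overline a_Vs$, $\overline\alpha_W(s)\le\overline a_Ws$ for all $s\ge0$, instead: $a_Y=a_W$, $\overline a_Y=\overline a_V+\overline a_W$, $\underline a_Y=a_W$, $\widetilde a_Y=a_Y/\overline a_Y$, $\beta(s,k)=\frac{\overline a_Y}{\underline a_Y}(1-\widetilde a_Y)^ks$ and $\widehat\alpha=\min\{\overline a_V,\overline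 a_Y-\underline a_Y\}\cdot\mathbb{I}$. Convention: $\mathbb{I}-\widetilde\alpha_Y$ is assumed non-decreasing; if it is not, $(\mathbb{I}-\widetilde\alpha_Y)^{(k)}$ in the formula of $\beta$ is replaced by $s\mapsto\max_{\hat s\in[0,s]}(\mathbb{I}-\widetilde\alpha_Y)^{(k)}(\hat s)$.
   Formalization: As printed, positive definiteness of α̃ fails (α̂ can vanish), and so does the linear case with c_W>1. Here α̃ is nondecreasing, nonnegative, zero at 0, and positive definite unless α̂ vanishes near 0; in the linear case a_W and ā_W are divided by max(1,c_W). *)

theory Defs
  imports "HOL-Analysis.Analysis"
begin

subsection \<open>Comparison functions\<close>

text \<open>Functions on the nonnegative reals are total functions on \<open>real\<close> whose values matter
  only on \<open>{0..}\<close>.\<close>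

definition class_Kinf :: "(real \<Rightarrow> real) \<Rightarrow> bool" where
  "class_Kinf g \<longleftrightarrow> continuous_on {0..} g \<and> strict_mono_on {0..} g \<and> g 0 = 0 \<and>
     \<not> bdd_above (g ` {0..})"

definition class_KL :: "(real \<Rightarrow> nat \<Rightarrow> real) \<Rightarrow> bool" where
  "class_KL \<beta> \<longleftrightarrow>
     (\<forall>s\<ge>0. \<forall>k. 0 \<le> \<beta> s k) \<and>
     (\<forall>k. mono_on {0..} (\<lambda>s. \<beta> s k) \<and> ((\<lambda>s. \<beta> s k) \<longlongrightarrow> 0) (at_right 0)) \<and>
     (\<forall>s\<ge>0. decseq (\<beta> s) \<and> \<beta> s \<longlonglongrightarrow> 0)"

definition positive_definite :: "(real \<Rightarrow> real) \<Rightarrow> bool" where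
  "positive_definite g \<longleftrightarrow> g 0 = 0 \<and> (\<forall>s>0. 0 < g s)"

text \<open>For \<open>g\<close> of class \<open>K\<^sub>\<infinity>\<close> this is the inverse function of the bijection \<open>g\<close> of \<open>{0..}\<close>.\<close>

abbreviation Kinv :: "(real \<Rightarrow> real) \<Rightarrow> real \<Rightarrow> real" where
  "Kinv g \<equiv> inv_into {0..} g"

text \<open>The maximum of \<open>g\<close> over \<open>{0..s}\<close>; it is attained whenever \<open>g\<close> is continuous there.\<close>

definition running_max :: "(real \<Rightarrow> real) \<Rightarrow> real \<Rightarrow> real" where
  "running_max g s = (SUP t\<in>{0..s}. g t)"


subsection \<open>Set-valued maps\<close>

definition selection :: "('a \<Rightarrow> 'b set) \<Rightarrow> ('a \<Rightarrow> 'b) \<Rightarrow> bool" where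
  "selection S h \<longleftrightarrow> (\<forall>x. S x \<noteq> {} \<longrightarrow> h x \<in> S x)"

definition outer_semicontinuous ::
    "('a::topological_space \<Rightarrow> 'b::topological_space set) \<Rightarrow> bool" where
  "outer_semicontinuous S \<longleftrightarrow>
     (\<forall>X v x u. X \<longlonglongrightarrow> x \<and> (\<forall>n. v n \<in> S (X n)) \<and> v \<longlonglongrightarrow> u \<longrightarrow> u \<in> S x)"

definition regularization ::
    "('a::metric_space \<Rightarrow> 'b::topological_space set) \<Rightarrow> 'a \<Rightarrow> 'b set" where
  "regularization S x = (\<Inter>\<delta>\<in>{0<..}. closure (\<Union>y\<in>cball x \<delta>. S y))"

definition lower_semicontinuous :: "('a::t2_space \<Rightarrow> ereal) \<Rightarrow> bool" where
  "lower_semicontinuous F \<longleftrightarrow> (\<forall>x. F x \<le> Liminf (at x) F)"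

definition level_bounded :: "('a::topological_space \<Rightarrow> 'b::metric_space \<Rightarrow> real) \<Rightarrow> bool" where
  "level_bounded l \<longleftrightarrow>
     (\<forall>x a. \<exists>S B. open S \<and> x \<in> S \<and> bounded B \<and> (\<forall>z\<in>S. {u. l z u \<le> a} \<subseteq> B))"


subsection \<open>Plant, costs and optimal value\<close>

text \<open>Costs are \<open>ereal\<close>-valued, since the series may diverge to \<open>\<infinity>\<close>.\<close>

primrec solution :: "('x \<Rightarrow> 'u \<Rightarrow> 'x) \<Rightarrow> 'x \<Rightarrow> (nat \<Rightarrow> 'u) \<Rightarrow> nat \<Rightarrow> 'x" where
  "solution f x u 0 = x"
| "solution f x u (Suc k) = f (solution f x u k) (u k)"

definition admissible :: "('x \<Rightarrow> 'u \<Rightarrow> 'x) \<Rightarrow> ('x \<Rightarrow> 'u set) \<Rightarrow> 'x \<Rightarrow> (nat \<Rightarrow> 'u) \<Rightarrow> bool" where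
  "admissible f U x u \<longleftrightarrow> (\<forall>k. u k \<in> U (solution f x u k))"

definition cost :: "('x \<Rightarrow> 'u \<Rightarrow> 'x) \<Rightarrow> ('x \<Rightarrow> 'u \<Rightarrow> real) \<Rightarrow> 'x \<Rightarrow> (nat \<Rightarrow> 'u) \<Rightarrow> ereal" where
  "cost f l x u = (\<Sum>k. ereal (l (solution f x u k) (u k)))"

primrec closed_loop :: "('x \<Rightarrow> 'u \<Rightarrow> 'x) \<Rightarrow> nat \<Rightarrow> 'x \<Rightarrow> ('x \<Rightarrow> 'u) \<Rightarrow> 'x" where
  "closed_loop f 0 x h = x"
| "closed_loop f (Suc k) x h = f (closed_loop f k x h) (h (closed_loop f k x h))"

definition policy_cost ::
    "('x \<Rightarrow> 'u \<Rightarrow> 'x) \<Rightarrow> ('x \<Rightarrow> 'u \<Rightarrow> real) \<Rightarrow> 'x \<Rightarrow> ('x \<Rightarrow> 'u) \<Rightarrow> ereal" where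
  "policy_cost f l x h = (\<Sum>k. ereal (l (closed_loop f k x h) (h (closed_loop f k x h))))"

text \<open>Minimal values are written as infima.\<close>

definition Vstar ::
    "('x \<Rightarrow> 'u \<Rightarrow> 'x) \<Rightarrow> ('x \<Rightarrow> 'u set) \<Rightarrow> ('x \<Rightarrow> 'u \<Rightarrow> real) \<Rightarrow> 'x \<Rightarrow> ereal" where
  "Vstar f U l x = (INF u\<in>{u. admissible f U x u}. cost f l x u)"

definition greedy_inputs ::
    "('x \<Rightarrow> 'u \<Rightarrow> 'x) \<Rightarrow> ('x \<Rightarrow> 'u set) \<Rightarrow> ('x \<Rightarrow> 'u \<Rightarrow> real) \<Rightarrow> ('x \<Rightarrow> ereal) \<Rightarrow> 'x \<Rightarrow> 'u set" where
  "greedy_inputs f U l V x =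
     {u. is_arg_min (\<lambda>u. ereal (l x u) + V (f x u)) (\<lambda>u. u \<in> U x) u}"

definition Hstar ::
    "('x \<Rightarrow> 'u \<Rightarrow> 'x) \<Rightarrow> ('x \<Rightarrow> 'u set) \<Rightarrow> ('x \<Rightarrow> 'u \<Rightarrow> real) \<Rightarrow> 'x \<Rightarrow> 'u set" where
  "Hstar f U l = greedy_inputs f U l (Vstar f U l)"


subsection \<open>The algorithm PI+\<close>

text \<open>The greedy map of \<open>V_r i\<close> is the map written \<open>H\<close> with index \<open>i+1\<close>, and its regularization is
  the map \<open>H_r\<close> with index \<open>i+1\<close>.\<close>

primrec V_r ::
    "('x::metric_space \<Rightarrow> 'u::topological_space \<Rightarrow> 'x) \<Rightarrow> ('x \<Rightarrow> 'u set) \<Rightarrow> ('x \<Rightarrow> 'u \<Rightarrow> real) \<Rightarrow>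
     ('x \<Rightarrow> 'u) \<Rightarrow> nat \<Rightarrow> 'x \<Rightarrow> ereal" where
  "V_r f U l h0 0 = (\<lambda>x. policy_cost f l x h0)"
| "V_r f U l h0 (Suc i) = (\<lambda>x.
     INF h\<in>{h. selection (regularization (greedy_inputs f U l (V_r f U l h0 i))) h}.
       policy_cost f l x h)"


subsection \<open>Functions in the near-optimality bound\<close>

text \<open>The arguments \<open>aW\<close>, \<open>\<chi>W\<close>, \<open>bW\<close>, \<open>bV\<close> stand for \<open>\<alpha>\<^sub>W\<close>, \<open>\<chi>\<^sub>W\<close> and the upper bounds (overlined)
  \<open>\<alpha>\<^sub>W\<close> and \<open>\<alpha>\<^sub>V\<close>; the suffixes \<open>low\<close> and \<open>up\<close> stand for under- and overlined \<open>\<alpha>\<^sub>Y\<close>.\<close>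

definition q_V :: "(real \<Rightarrow> real) \<Rightarrow> real \<Rightarrow> real" where
  "q_V \<chi>W s = 2 * \<chi>W (2 * s)"

definition q_W :: "(real \<Rightarrow> real) \<Rightarrow> (real \<Rightarrow> real) \<Rightarrow> (real \<Rightarrow> real) \<Rightarrow> real \<Rightarrow> real" where
  "q_W aW \<chi>W bW s =
     1/2 * Kinv (\<lambda>t. \<chi>W t + (bW (Kinv aW (2 * \<chi>W t)) + Kinv aW (2 * \<chi>W t))) s"

definition rho_V :: "(real \<Rightarrow> real) \<Rightarrow> real \<Rightarrow> real" where
  "rho_V \<chi>W s = integral {0..s} (q_V \<chi>W)"

definition rho_W :: "(real \<Rightarrow> real) \<Rightarrow> (real \<Rightarrow> real) \<Rightarrow> (real \<Rightarrow> real) \<Rightarrow> real \<Rightarrow> real" where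
  "rho_W aW \<chi>W bW s = integral {0..s} (q_W aW \<chi>W bW)"

definition alpha_Y :: "(real \<Rightarrow> real) \<Rightarrow> (real \<Rightarrow> real) \<Rightarrow> (real \<Rightarrow> real) \<Rightarrow> real \<Rightarrow> real" where
  "alpha_Y aW \<chi>W bW s = q_W aW \<chi>W bW (1/4 * aW s) * (1/4 * aW s)"

definition alpha_Y_up ::
    "(real \<Rightarrow> real) \<Rightarrow> (real \<Rightarrow> real) \<Rightarrow> (real \<Rightarrow> real) \<Rightarrow> (real \<Rightarrow> real) \<Rightarrow> real \<Rightarrow> real" where
  "alpha_Y_up aW \<chi>W bW bV s = rho_V \<chi>W (bV s) + rho_W aW \<chi>W bW (bW s)"

definition alpha_Y_low :: "(real \<Rightarrow> real) \<Rightarrow> (real \<Rightarrow> real) \<Rightarrow> (real \<Rightarrow> real) \<Rightarrow> real \<Rightarrow> real" where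
  "alpha_Y_low aW \<chi>W bW s =
     min (rho_V \<chi>W (Kinv \<chi>W (1/2 * aW s))) (rho_W aW \<chi>W bW (1/2 * aW s))"

definition alpha_hat ::
    "(real \<Rightarrow> real) \<Rightarrow> (real \<Rightarrow> real) \<Rightarrow> (real \<Rightarrow> real) \<Rightarrow> (real \<Rightarrow> real) \<Rightarrow> real \<Rightarrow> real" where
  "alpha_hat aW \<chi>W bW bV s = bV s - Kinv \<chi>W (max 0 (aW s - bW s))"

text \<open>The \<open>k\<close>-fold iterate of \<open>\<I> - a\<close>, replaced by its running maximum if \<open>\<I> - a\<close> is not
  nondecreasing.\<close>

definition decay_iterate :: "(real \<Rightarrow> real) \<Rightarrow> nat \<Rightarrow> real \<Rightarrow> real" where
  "decay_iterate a k =
     (if mono_on {0..} (\<lambda>s. s - a s) then (\<lambda>s. s - a s) ^^ k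
      else running_max ((\<lambda>s. s - a s) ^^ k))"

definition decay_bound ::
    "(real \<Rightarrow> real) \<Rightarrow> (real \<Rightarrow> real) \<Rightarrow> (real \<Rightarrow> real) \<Rightarrow> real \<Rightarrow> nat \<Rightarrow> real" where
  "decay_bound aY low up s k = Kinv low (decay_iterate (aY \<circ> Kinv up) k (up s))"

definition linear_decay_bound :: "real \<Rightarrow> real \<Rightarrow> real \<Rightarrow> real \<Rightarrow> nat \<Rightarrow> real" where
  "linear_decay_bound aY low up s k = up / low * (1 - aY / up) ^ k * s"

end

theory Submission
  imports Defs
begin

text \<open>Value functions are handled through closedness of their sublevel sets. For an outer
  semicontinuous set-valued policy \<open>S\<close> the best cost over selections of \<open>S\<close> is the supremum of the
  finite-horizon values over inputs in \<open>S\<close>; level-boundedness of \<open>l\<close> makes every horizon attain its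
  minimum and lets the minimizers accumulate, so that the supremum again has closed sublevel sets and
  satisfies the Bellman equation. Hence all greedy maps of the algorithm are nonempty, and one greedy
  step gives \<open>V_r (i + 1) x \<le> l x u + V_r i (f x u)\<close> for every \<open>u \<in> U x\<close>. With \<open>u\<close> an optimal input and
  the Bellman equation for the optimal value, the gap to the optimum at \<open>x\<close> is bounded by the gap of the
  previous iterate at the next state of the optimal closed loop.

  Along that closed loop \<open>Y = rho_V V + rho_W W\<close> (or \<open>V + W\<close>, \<open>V + W / c\<close> in the special cases),
  with \<open>V\<close> the optimal value, decreases by \<open>alpha_Y \<sigma>\<close>. This bounds \<open>\<sigma>\<close> by \<open>\<beta>\<close>, and it forces \<open>\<sigma>\<close> to
  be arbitrarily small somewhere, so by connectedness \<open>\<sigma>\<close> takes every positive value. The inequalities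
  between comparison functions that \<open>\<beta>\<close> of class \<open>KL\<close> and nonnegativity of \<open>ahat\<close> need can therefore
  be read off along states.\<close>

subsection \<open>Comparison functions\<close>

lemma class_KinfI:
  assumes "continuous_on {0..} g" "\<And>x y. 0 \<le> x \<Longrightarrow> x < y \<Longrightarrow> g x < g y" "g 0 = 0"
    and "\<And>y. \<exists>x\<ge>0. y \<le> g x"
  shows "class_Kinf g"
proof -
  have "\<not> bdd_above (g ` {0..})"
  proof
    assume "bdd_above (g ` {0..})"
    then obtain M where M: "\<And>x. x \<ge> 0 \<Longrightarrow> g x \<le> M"
      by (auto simp: bdd_above_def)
    from assms(4)[of "M + 1"] obtain x where "x \<ge> 0" "M + 1 \<le> g x" by blast
    with M[of x] show False by simp
  qed
  with assms show ?thesis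
    unfolding class_Kinf_def by (auto intro!: strict_mono_onI)
qed

context
  fixes g :: "real \<Rightarrow> real"
  assumes g: "class_Kinf g"
begin

lemma class_Kinf_continuous: "continuous_on {0..} g"
  and class_Kinf_zero: "g 0 = 0"
  using g by (auto simp: class_Kinf_def)

lemma class_Kinf_less: "0 \<le> x \<Longrightarrow> x < y \<Longrightarrow> g x < g y"
  using g by (auto simp: class_Kinf_def strict_mono_on_def)

lemma class_Kinf_mono: "0 \<le> x \<Longrightarrow> x \<le> y \<Longrightarrow> g x \<le> g y"
  using class_Kinf_less[of x y] by (cases "x = y") auto

lemma class_Kinf_nonneg: "0 \<le> x \<Longrightarrow> 0 \<le> g x"
  using class_Kinf_mono[of 0 x] class_Kinf_zero by simp

lemma class_Kinf_pos: "0 < x \<Longrightarrow> 0 < g x"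
  using class_Kinf_less[of 0 x] class_Kinf_zero by simp

lemma class_Kinf_le_iff: "0 \<le> x \<Longrightarrow> 0 \<le> y \<Longrightarrow> g x \<le> g y \<longleftrightarrow> x \<le> y"
  using class_Kinf_less[of y x] class_Kinf_mono[of x y] by force

lemma class_Kinf_unbounded: "\<exists>x\<ge>0. y \<le> g x"
  using g unfolding class_Kinf_def bdd_above_def by (metis atLeast_iff imageE linorder_le_cases)

lemma class_Kinf_surj: 
  assumes "0 \<le> y"
  shows "\<exists>x\<ge>0. g x = y"
proof -
  obtain z where z: "z \<ge> 0" "y \<le> g z" using class_Kinf_unbounded by blast
  have "\<exists>x\<ge>0. x \<le> z \<and> g x = y"
    using z assms class_Kinf_zero
    by (intro IVT') (auto intro: continuous_on_subset[OF class_Kinf_continuous])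
  then show ?thesis by blast
qed

lemma class_Kinf_image: "g ` {0..} = {0..}"
  using class_Kinf_surj class_Kinf_nonneg by (fastforce simp: image_iff)

lemma Kinv_nonneg: "0 \<le> y \<Longrightarrow> 0 \<le> Kinv g y"
  using inv_into_into[of y g "{0..}"] class_Kinf_image by auto

lemma Kinv_right: "0 \<le> y \<Longrightarrow> g (Kinv g y) = y"
  using f_inv_into_f[of y g "{0..}"] class_Kinf_image by auto

lemma Kinv_left: "0 \<le> x \<Longrightarrow> Kinv g (g x) = x"
  using g by (auto simp: class_Kinf_def intro!: inv_into_f_f strict_mono_on_imp_inj_on)

lemma Kinv_le_iff: "0 \<le> x \<Longrightarrow> 0 \<le> y \<Longrightarrow> Kinv g y \<le> x \<longleftrightarrow> y \<le> g x"
  by (metis Kinv_nonneg Kinv_right class_Kinf_le_iff)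

lemma class_Kinf_Kinv: "class_Kinf (Kinv g)"
proof (rule class_KinfI)
  show less: "Kinv g x < Kinv g y" if "0 \<le> x" "x < y" for x y
    using that Kinv_le_iff[of "Kinv g x" y] Kinv_nonneg[of x] Kinv_right[of x] by auto
  show "Kinv g 0 = 0"
    using Kinv_left[of 0] class_Kinf_zero by simp
  show "\<exists>x\<ge>0. y \<le> Kinv g x" for y
    by (intro exI[of _ "g \<bar>y\<bar>"]) (simp add: class_Kinf_nonneg Kinv_left)
  show "continuous_on {0..} (Kinv g)"
    unfolding continuous_on_iff
  proof (intro ballI allI impI)
    fix y e :: real
    assume y: "y \<in> {0..}" and e: "0 < e"
    define x where "x = Kinv g y"
    have x: "0 \<le> x" "g x = y" using y by (auto simp: x_def Kinv_nonneg Kinv_right)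
    \<comment> \<open>By monotonicity \<open>Kinv g z\<close> lies within \<open>e\<close> of
      \<open>x\<close> once \<open>z\<close> lies between \<open>g (x - e)\<close> and
      \<open>g (x + e)\<close>. If \<open>x < e\<close>, the left end leaves the domain;
      nonnegativity of \<open>Kinv g z\<close> suffices there and \<open>1\<close> is a dummy
      radius.\<close>
    define d where "d = min (g (x + e) - y) (if x < e then 1 else y - g (x - e))"
    have "d > 0" using x e class_Kinf_less[of x "x + e"] class_Kinf_less[of "x - e" x]
      by (auto simp: d_def)
    moreover have "dist (Kinv g z) x < e" if z: "z \<in> {0..}" "dist z y < d" for z
    proof -
      have *: "0 \<le> Kinv g z" "g (Kinv g z) = z" using z by (auto simp: Kinv_nonneg Kinv_right)
      have "g (Kinv g z) < g (x + e)" using z(2) * by (auto simp: d_def dist_real_def)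
      then have "Kinv g z < x + e" using * x e class_Kinf_mono[of "x + e" "Kinv g z"] by force
      moreover have "x - e < Kinv g z"
      proof (cases "x < e")
        case False
        then have "g (x - e) < g (Kinv g z)" using z(2) * by (auto simp: d_def dist_real_def)
        then show ?thesis using * class_Kinf_mono[of "Kinv g z" "x - e"] by force
      qed (use * in auto)
      ultimately show ?thesis by (auto simp: dist_real_def)
    qed
    ultimately show "\<exists>d>0. \<forall>z\<in>{0..}. dist z y < d \<longrightarrow> dist (Kinv g z) (Kinv g y) < e"
      unfolding x_def by blast
  qed
qed

end

lemma class_Kinf_linear: "0 < c \<Longrightarrow> class_Kinf (\<lambda>s. c * s)"
proof (rule class_KinfI)
  show "\<exists>x\<ge>0. y \<le> c * x" if "0 < c" for y
    using that by (intro exI[of _ "\<bar>y\<bar> / c"]) auto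
qed (auto intro!: continuous_intros)

lemma class_Kinf_compose:
  assumes "class_Kinf g" "class_Kinf h"
  shows "class_Kinf (\<lambda>s. g (h s))"
proof (rule class_KinfI)
  show "continuous_on {0..} (\<lambda>s. g (h s))"
    using assms by (intro continuous_on_compose2[OF class_Kinf_continuous class_Kinf_continuous])
      (auto simp: class_Kinf_nonneg)
  show "\<exists>x\<ge>0. y \<le> g (h x)" for y
  proof -
    obtain z where z: "z \<ge> 0" "y \<le> g z" using class_Kinf_unbounded[OF assms(1)] by blast
    then obtain x where "x \<ge> 0" "h x = z" using class_Kinf_surj[OF assms(2)] by blast
    with z show ?thesis by blast
  qed
qed (simp_all add: class_Kinf_zero[OF assms(1)] class_Kinf_zero[OF assms(2)]
    class_Kinf_less[OF assms(1)] class_Kinf_less[OF assms(2)] class_Kinf_nonneg[OF assms(2)])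

lemma class_Kinf_add:
  assumes "class_Kinf g" "continuous_on {0..} h" "mono_on {0..} h" "h 0 = 0"
  shows "class_Kinf (\<lambda>s. g s + h s)"
proof (rule class_KinfI)
  show "\<exists>x\<ge>0. y \<le> g x + h x" for y
  proof -
    obtain x where x: "x \<ge> 0" "y \<le> g x" using class_Kinf_unbounded[OF assms(1)] by blast
    then show ?thesis using monotone_onD[OF assms(3), of 0 x] assms(4) by (intro exI[of _ x]) auto
  qed
  show "g x + h x < g y + h y" if "0 \<le> x" "x < y" for x y
    using class_Kinf_less[OF assms(1) that] monotone_onD[OF assms(3), of x y] that by auto
qed (use assms class_Kinf_zero[OF assms(1)] in
    \<open>auto intro!: continuous_on_add class_Kinf_continuous[of g]\<close>)

lemma class_Kinf_mono_on: "class_Kinf g \<Longrightarrow> mono_on {0..} g"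
  by (rule mono_onI) (simp add: class_Kinf_mono[of g])

lemma class_Kinf_min:
  assumes g: "class_Kinf g" and h: "class_Kinf h"
  shows "class_Kinf (\<lambda>s. min (g s) (h s))"
proof (rule class_KinfI)
  show "\<exists>x\<ge>0. y \<le> min (g x) (h x)" for y
  proof -
    obtain a b where ab: "a \<ge> 0" "y \<le> g a" "b \<ge> 0" "y \<le> h b"
      using class_Kinf_unbounded[OF g] class_Kinf_unbounded[OF h] by blast
    then show ?thesis
      using class_Kinf_mono[OF g, of a "max a b"] class_Kinf_mono[OF h, of b "max a b"]
      by (intro exI[of _ "max a b"]) auto
  qed
  show "min (g x) (h x) < min (g y) (h y)" if "0 \<le> x" "x < y" for x y
    using class_Kinf_less[OF g that] class_Kinf_less[OF h that] by auto
qed (use class_Kinf_zero[OF g] class_Kinf_zero[OF h] in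
    \<open>auto intro!: continuous_on_min class_Kinf_continuous[OF g] class_Kinf_continuous[OF h]\<close>)

section \<open>Integrals of \<open>class_Kinf\<close> functions\<close>

context
  fixes q :: "real \<Rightarrow> real"
  assumes q: "class_Kinf q"
begin

text \<open>Rectangle bounds for a monotone integrand; they drive the later estimates of
  \<open>rho_V\<close> and \<open>rho_W\<close>.\<close>

lemma integral_class_Kinf_bounds:
  assumes "0 \<le> a" "a \<le> b"
  shows "q a * (b - a) \<le> integral {0..b} q - integral {0..a} q"
    and "integral {0..b} q - integral {0..a} q \<le> q b * (b - a)"
proof -
  have int: "q integrable_on {u..v}" if "0 \<le> u" for u v
    using that
    by (intro integrable_continuous_interval continuous_on_subset[OF class_Kinf_continuous[OF q]]) auto
  have eq: "integral {0..b} q - integral {0..a} q = integral {a..b} q"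
    using Henstock_Kurzweil_Integration.integral_combine[OF assms int[of 0 b]] by simp
  have const: "integral {a..b} (\<lambda>_. c) = c * (b - a)" for c :: real
    using assms by simp
  show "q a * (b - a) \<le> integral {0..b} q - integral {0..a} q"
    unfolding eq const[symmetric] using assms
    by (intro integral_le int) (auto intro!: class_Kinf_mono[OF q])
  show "integral {0..b} q - integral {0..a} q \<le> q b * (b - a)"
    unfolding eq const[symmetric] using assms
    by (intro integral_le int) (auto intro!: class_Kinf_mono[OF q])
qed

lemma class_Kinf_integral: "class_Kinf (\<lambda>s. integral {0..s} q)"
proof (rule class_KinfI)
  show "continuous_on {0..} (\<lambda>s. integral {0..s} q)"
    unfolding continuous_on_eq_continuous_within
  proof
    fix x :: real assume x: "x \<in> {0..}"
    have "continuous_on {0..x + 1} (\<lambda>s. integral {0..s} q)"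
      by (intro indefinite_integral_continuous_1 integrable_continuous_interval
          continuous_on_subset[OF class_Kinf_continuous[OF q]]) auto
    then have "continuous (at x within {0..x + 1}) (\<lambda>s. integral {0..s} q)"
      using x by (auto simp: continuous_on_eq_continuous_within)
    moreover have "at x within {0..x + 1} = at x within {0..}"
      using x by (intro at_within_nhd[of _ "{..<x + 1}"]) auto
    ultimately show "continuous (at x within {0..}) (\<lambda>s. integral {0..s} q)"
      by (simp add: continuous_within)
  qed
  show less: "integral {0..x} q < integral {0..y} q" if "0 \<le> x" "x < y" for x y
  proof -
    \<comment> \<open>\<open>q x\<close> vanishes for \<open>x = 0\<close>, so strictness is taken
      from the right half, where the integrand is at least \<open>q m > 0\<close>.\<close>
    define m where "m = (x + y) / 2"
    have m: "x < m" "m < y" using that by (auto simp: m_def)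
    have "0 \<le> q x * (m - x)" "0 < q m * (y - m)"
      using m that by (auto intro!: mult_nonneg_nonneg mult_pos_pos class_Kinf_nonneg[OF q] class_Kinf_pos[OF q])
    with integral_class_Kinf_bounds(1)[of x m] integral_class_Kinf_bounds(1)[of m y] m that
    show ?thesis by auto
  qed
  show "\<exists>x\<ge>0. y \<le> integral {0..x} q" for y
  proof (intro exI conjI)
    \<comment> \<open>Beyond \<open>1\<close> the integrand is at least \<open>q 1\<close>, so the
      integral grows at least linearly.\<close>
    define c where "c = q 1"
    have c: "c > 0" using class_Kinf_pos[OF q, of 1] by (simp add: c_def)
    show "y \<le> integral {0..1 + \<bar>y\<bar> / c} q"
      using integral_class_Kinf_bounds(1)[of 1 "1 + \<bar>y\<bar> / c"] less[of 0 1] c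
      by (auto simp flip: c_def)
    show "0 \<le> 1 + \<bar>y\<bar> / c" using c by auto
  qed
qed auto

end

subsection \<open>Decay bounds\<close>

lemma running_max_eqI:
  assumes "h ` {0..s} = {0..M}" "0 \<le> M"
  shows "running_max h s = M"
  unfolding running_max_def assms(1) using assms(2) by simp

text \<open>The running maximum of an iterate of \<open>\<I> - a\<close> is the iterate of the running maximum, because
  the iterates map \<open>{0..s}\<close> onto an interval with left end \<open>0\<close>.\<close>

context
  fixes a :: "real \<Rightarrow> real"
  assumes a_cont: "continuous_on {0..} a" and a_zero: "a 0 = 0"
    and pos: "\<forall>s>0. 0 < a s" and le: "\<forall>s\<ge>0. a s \<le> s"
begin

private lemmas a_pos = pos[rule_format] and a_le = le[rule_format]

private abbreviation "g \<equiv> \<lambda>s. s - a s"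
private abbreviation "G \<equiv> running_max g"

text \<open>The maximum is attained by compactness, and the intermediate value theorem gives every
  value between it and \<open>g 0 = 0\<close>; \<open>a s \<le> s\<close> excludes negative
  values.\<close>

lemma diff_image:
  assumes "0 \<le> r"
  shows "g ` {0..r} = {0..G r}" "0 \<le> G r"
proof -
  have cont: "continuous_on {0..r} g"
    by (intro continuous_on_diff continuous_on_id continuous_on_subset[OF a_cont]) auto
  obtain t where t: "t \<in> {0..r}" "\<And>s. s \<in> {0..r} \<Longrightarrow> g s \<le> g t"
    using continuous_attains_sup[OF _ _ cont] assms by auto
  have "x \<in> g ` {0..r}" if x: "x \<in> {0..g t}" for x
  proof -
    have "\<exists>s\<ge>0. s \<le> t \<and> g s = x"
      using t x a_zero by (intro IVT'[of g] continuous_on_subset[OF cont]) auto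
    then show ?thesis using t(1) by force
  qed
  moreover have "g s \<in> {0..g t}" if "s \<in> {0..r}" for s
    using t(2)[OF that] a_le[of s] that by auto
  ultimately have image: "g ` {0..r} = {0..g t}" by blast
  moreover have "0 \<le> g t" using t(1) a_le[of t] by auto
  ultimately have "G r = g t" by (rule running_max_eqI)
  with image \<open>0 \<le> g t\<close> show "g ` {0..r} = {0..G r}" "0 \<le> G r" by auto
qed

lemma funpow_diff_image:
  assumes "0 \<le> s"
  shows "(g ^^ k) ` {0..s} = {0..(G ^^ k) s} \<and> 0 \<le> (G ^^ k) s"
proof (induction k)
  case (Suc k)
  have "(g ^^ Suc k) ` {0..s} = g ` ((g ^^ k) ` {0..s})" by (auto simp: image_image)
  with Suc diff_image[of "(G ^^ k) s"] show ?case by simp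
qed (use assms in auto)

text \<open>Both branches of \<open>decay_iterate\<close> collapse to one formula, so the later
  arguments need not split on monotonicity of \<open>g\<close>. In the monotone branch the right
  endpoint attains the maximum.\<close>

lemma decay_iterate_eq:
  assumes "0 \<le> s"
  shows "decay_iterate a k s = (G ^^ k) s"
proof (cases "mono_on {0..} g")
  case True
  have "mono_on {0..} (g ^^ k) \<and> (\<forall>t\<ge>0. 0 \<le> (g ^^ k) t)"
  proof (induction k)
    case (Suc k)
    then show ?case using True a_le by (auto simp: monotone_on_def)
  qed (auto simp: monotone_on_def)
  then have mono: "mono_on {0..} (g ^^ k)" by blast
  note image = funpow_diff_image[OF assms, of k]
  then obtain t where t: "t \<in> {0..s}" "(G ^^ k) s = (g ^^ k) t" by fastforce
  then have "(G ^^ k) s \<le> (g ^^ k) s" using mono_onD[OF mono, of t s] by auto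
  moreover have "(g ^^ k) s \<in> (g ^^ k) ` {0..s}" using assms by auto
  then have "(g ^^ k) s \<le> (G ^^ k) s" using image by auto
  ultimately show ?thesis using True by (simp add: decay_iterate_def)
next
  case False
  then show ?thesis
    using funpow_diff_image[OF assms, of k]
    by (auto simp: decay_iterate_def intro!: running_max_eqI)
qed

lemma decay_iterate_nonneg: "0 \<le> s \<Longrightarrow> 0 \<le> decay_iterate a k s"
  using funpow_diff_image by (simp add: decay_iterate_eq)

lemma decay_iterate_0: "0 \<le> s \<Longrightarrow> decay_iterate a 0 s = s"
  by (simp add: decay_iterate_eq)

lemma decay_iterate_Suc_attained:
  assumes "0 \<le> s"
  shows "\<exists>t\<in>{0..decay_iterate a k s}. decay_iterate a (Suc k) s = t - a t"
proof -
  have "(G ^^ Suc k) s \<in> g ` {0..(G ^^ k) s}"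
    using diff_image[of "(G ^^ k) s"] funpow_diff_image[OF assms, of k] by simp
  then show ?thesis using assms unfolding decay_iterate_eq[OF assms] by blast
qed

lemma decay_iterate_Suc_ge:
  assumes "0 \<le> s" "0 \<le> y" "y \<le> decay_iterate a k s"
  shows "y - a y \<le> decay_iterate a (Suc k) s"
proof -
  have "y - a y \<in> g ` {0..(G ^^ k) s}"
    using assms by (auto simp: decay_iterate_eq)
  then show ?thesis
    using diff_image[of "(G ^^ k) s"] funpow_diff_image[of s k] assms by (simp add: decay_iterate_eq)
qed

lemma decay_iterate_mono:
  assumes "0 \<le> s" "s \<le> t"
  shows "decay_iterate a k s \<le> decay_iterate a k t"
proof -
  have "{0..(G ^^ k) s} \<subseteq> {0..(G ^^ k) t}"
    using funpow_diff_image[of s k] funpow_diff_image[of t k] assms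
      image_mono[of "{0..s}" "{0..t}" "g ^^ k"] by simp
  then show ?thesis using funpow_diff_image[of s k] assms by (simp add: decay_iterate_eq)
qed

lemma decay_iterate_decseq:
  assumes "0 \<le> s"
  shows "decseq (\<lambda>k. decay_iterate a k s)"
proof (rule decseq_SucI)
  fix k
  obtain t where t: "t \<in> {0..decay_iterate a k s}" "decay_iterate a (Suc k) s = t - a t"
    using decay_iterate_Suc_attained[OF assms] by blast
  have "0 \<le> a t" using a_pos[of t] a_zero t by (cases "t = 0") auto
  with t show "decay_iterate a (Suc k) s \<le> decay_iterate a k s" by auto
qed

text \<open>The points \<open>t k\<close> with \<open>?D (Suc k) = t k - a (t k)\<close> are
  squeezed between the limit \<open>L\<close> and \<open>?D k\<close>. Passing to the limit in this
  recursion gives \<open>a L = 0\<close>, hence \<open>L = 0\<close>.\<close>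

lemma decay_iterate_tendsto_0:
  assumes "0 \<le> s"
  shows "(\<lambda>k. decay_iterate a k s) \<longlonglongrightarrow> 0"
proof -
  let ?D = "\<lambda>k. decay_iterate a k s"
  obtain L where L: "?D \<longlonglongrightarrow> L" "\<And>k. L \<le> ?D k"
    using decseq_convergent[OF decay_iterate_decseq[OF assms], of 0] decay_iterate_nonneg[OF assms]
    by blast
  have L0: "0 \<le> L" by (rule LIMSEQ_le_const[OF L(1)]) (use decay_iterate_nonneg[OF assms] in auto)
  obtain t where t: "\<And>k. t k \<in> {0..?D k}" "\<And>k. ?D (Suc k) = t k - a (t k)"
    using decay_iterate_Suc_attained[OF assms] by metis
  have a_nonneg: "0 \<le> a (t k)" for k using a_pos[of "t k"] a_zero t(1)[of k] by (cases "t k = 0") auto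
  have "L \<le> t k" for k using L(2)[of "Suc k"] t(2)[of k] a_nonneg[of k] by simp
  then have tL: "t \<longlonglongrightarrow> L"
    using t(1) by (intro tendsto_sandwich[OF _ _ tendsto_const L(1)]) auto
  have "(\<lambda>k. a (t k)) \<longlonglongrightarrow> a L"
    using t(1) L0 by (intro continuous_on_tendsto_compose[OF a_cont tL]) auto
  with tL have "(\<lambda>k. ?D (Suc k)) \<longlonglongrightarrow> L - a L"
    unfolding t(2) by (rule tendsto_diff)
  then have "L - a L = L" by (rule LIMSEQ_unique[OF _ LIMSEQ_Suc[OF L(1)]])
  then have "a L = 0" by simp
  with a_pos[of L] L0 have "L = 0" by (cases "L = 0") auto
  with L(1) show ?thesis by simp
qed

end

section \<open>From a Lyapunov decrease to a \<open>class_KL\<close> bound\<close>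

context
  fixes aY low up :: "real \<Rightarrow> real"
  assumes aY_cont: "continuous_on {0..} aY" and aY_zero: "aY 0 = 0"
    and aY_pos: "\<And>s. 0 < s \<Longrightarrow> 0 < aY s" and aY_le: "\<And>s. 0 \<le> s \<Longrightarrow> aY s \<le> up s"
    and low: "class_Kinf low" and up: "class_Kinf up"
begin

private abbreviation "a \<equiv> aY \<circ> Kinv up"

lemma comp_Kinv_props:
  "continuous_on {0..} a" "a 0 = 0" "\<forall>s>0. 0 < a s" "\<forall>s\<ge>0. a s \<le> s"
proof -
  note inv = class_Kinf_Kinv[OF up]
  show "continuous_on {0..} a"
    unfolding comp_def using class_Kinf_nonneg[OF inv]
    by (intro continuous_on_compose2[OF aY_cont class_Kinf_continuous[OF inv]]) auto
  show "a 0 = 0" by (simp add: class_Kinf_zero[OF inv] aY_zero)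
  show "\<forall>s>0. 0 < a s" by (simp add: aY_pos class_Kinf_pos[OF inv])
  show "\<forall>s\<ge>0. a s \<le> s"
  proof (intro allI impI)
    show "a s \<le> s" if "0 \<le> s" for s
      using aY_le[of "Kinv up s"] that by (simp add: Kinv_nonneg[OF up] Kinv_right[OF up])
  qed
qed

private lemmas decay =
  decay_iterate_nonneg[OF comp_Kinv_props] decay_iterate_0[OF comp_Kinv_props]
  decay_iterate_mono[OF comp_Kinv_props] decay_iterate_decseq[OF comp_Kinv_props]
  decay_iterate_tendsto_0[OF comp_Kinv_props] decay_iterate_Suc_ge[OF comp_Kinv_props]

lemma class_KL_decay_bound: "class_KL (decay_bound aY low up)"
proof -
  note low_inv = class_Kinf_Kinv[OF low] and up_nonneg = class_Kinf_nonneg[OF up]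
  let ?b = "decay_bound aY low up"
  have nonneg: "0 \<le> ?b s k" if "0 \<le> s" for s k
    unfolding decay_bound_def using that by (intro Kinv_nonneg[OF low] decay up_nonneg)
  have dec: "decseq (?b s)" if "0 \<le> s" for s
    unfolding decay_bound_def decseq_def
    by (intro allI impI class_Kinf_mono[OF low_inv] decay(1) decseqD[OF decay(4)] up_nonneg that)
  have lim: "?b s \<longlonglongrightarrow> 0" if "0 \<le> s" for s
  proof -
    have "(\<lambda>k. Kinv low (decay_iterate a k (up s))) \<longlonglongrightarrow> Kinv low 0"
      using decay(1)[OF up_nonneg[OF that]]
      by (intro continuous_on_tendsto_compose[OF class_Kinf_continuous[OF low_inv]]
          decay(5) up_nonneg that always_eventually allI) (simp_all only: atLeast_iff order_refl)
    then show ?thesis unfolding decay_bound_def by (simp add: class_Kinf_zero[OF low_inv])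
  qed
  have mono: "mono_on {0..} (\<lambda>s. ?b s k)" for k
    unfolding decay_bound_def
    by (intro mono_onI class_Kinf_mono[OF low_inv] decay class_Kinf_mono[OF up] up_nonneg) auto
  \<comment> \<open>Monotonicity in \<open>k\<close> reduces this to \<open>k = 0\<close>, where the
    bound is \<open>Kinv low (up s)\<close>, continuous and zero at zero.\<close>
  have zero: "((\<lambda>s. ?b s k) \<longlongrightarrow> 0) (at_right 0)" for k
  proof (rule tendsto_sandwich[OF _ _ tendsto_const])
    have "continuous_on {0..} (\<lambda>s. Kinv low (up s))"
      by (rule class_Kinf_continuous[OF class_Kinf_compose[OF low_inv up]])
    then have "((\<lambda>s. Kinv low (up s)) \<longlongrightarrow> Kinv low (up 0)) (at 0 within {0..})"
      by (auto simp: continuous_on_def)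
    then show "((\<lambda>s. Kinv low (up s)) \<longlongrightarrow> 0) (at_right 0)"
      by (simp add: class_Kinf_zero[OF low_inv] class_Kinf_zero[OF up])
        (erule tendsto_within_subset, auto)
    show "\<forall>\<^sub>F s in at_right 0. 0 \<le> ?b s k"
      using nonneg by (auto simp: eventually_at_right_field intro!: exI[of _ 1])
    have "?b s k \<le> Kinv low (up s)" if "0 \<le> s" for s
      using decseqD[OF dec[OF that], of 0 k] unfolding decay_bound_def decay(2)[OF up_nonneg[OF that]] by simp
    then show "\<forall>\<^sub>F s in at_right 0. ?b s k \<le> Kinv low (up s)"
      by (auto simp: eventually_at_right_field intro!: exI[of _ 1])
  qed
  show ?thesis unfolding class_KL_def using nonneg dec lim mono zero by blast
qed

text \<open>From \<open>y k \<le> up (s k)\<close> and monotonicity of \<open>aY\<close>,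
  \<open>y\<close> obeys the scalar recursion \<open>y (Suc k) \<le> y k - a (y k)\<close>.
  \<open>decay_iterate_Suc_ge\<close> compares it with the iterates even if
  \<open>\<lambda>s. s - a s\<close> is not monotone.\<close>

lemma le_decay_bound:
  fixes y s :: "nat \<Rightarrow> real"
  assumes aY_mono: "mono_on {0..} aY"
    and s: "\<And>k. 0 \<le> s k" and y: "\<And>k. low (s k) \<le> y k" "\<And>k. y k \<le> up (s k)"
    and step: "\<And>k. y (Suc k) \<le> y k - aY (s k)"
  shows "s k \<le> decay_bound aY low up (s 0) k"
proof -
  have y0: "0 \<le> y k" for k using y(1)[of k] class_Kinf_nonneg[OF low s[of k]] by simp
  have "y k \<le> decay_iterate a k (up (s 0))"
  proof (induction k)
    case 0
    show ?case unfolding decay(2)[OF class_Kinf_nonneg[OF up s]] by (rule y(2))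
  next
    case (Suc k)
    have "Kinv up (y k) \<le> s k" using Kinv_le_iff[OF up s y0] y(2) by blast
    then have "a (y k) \<le> aY (s k)"
      using Kinv_nonneg[OF up y0[of k]] s[of k] by (auto intro!: mono_onD[OF aY_mono])
    with step[of k] decay(6)[OF class_Kinf_nonneg[OF up s] y0 Suc] show ?case by linarith
  qed
  with y(1)[of k] have "low (s k) \<le> decay_iterate a k (up (s 0))" by simp
  then show ?thesis
    unfolding decay_bound_def
    using Kinv_left[OF low s] class_Kinf_mono[OF class_Kinf_Kinv[OF low] class_Kinf_nonneg[OF low s]]
    by metis
qed

end

lemma class_KL_linear_decay_bound:
  assumes "0 < aY" "aY \<le> up" "0 < low"
  shows "class_KL (linear_decay_bound aY low up)"
proof -
  define q where "q = 1 - aY / up"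
  define c where "c = up / low"
  have q: "0 \<le> q" "q < 1" and c: "0 < c" using assms by (auto simp: q_def c_def)
  have eq: "linear_decay_bound aY low up = (\<lambda>s k. c * q ^ k * s)"
    by (simp add: fun_eq_iff linear_decay_bound_def q_def c_def)
  have "decseq (\<lambda>k. c * q ^ k * s)" if "0 \<le> s" for s
    using that q c by (intro decseq_SucI mult_right_mono mult_left_mono) (auto intro: mult_left_le_one_le)
  moreover have "(\<lambda>k. c * q ^ k * s) \<longlonglongrightarrow> c * 0 * s" for s
    using q by (intro tendsto_intros) auto
  moreover have "((\<lambda>s. c * q ^ k * s) \<longlongrightarrow> c * q ^ k * 0) (at_right 0)" for k
    by (intro tendsto_intros)
  moreover have "mono_on {0..} (\<lambda>s. c * q ^ k * s)" for k
    using q c by (intro mono_onI mult_left_mono) auto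
  ultimately show ?thesis unfolding class_KL_def eq using q c by auto
qed

lemma le_linear_decay_bound:
  fixes y s :: "nat \<Rightarrow> real"
  assumes "0 < aY" "aY \<le> up" "0 < low"
    and y: "\<And>k. low * s k \<le> y k" "\<And>k. y k \<le> up * s k"
    and step: "\<And>k. y (Suc k) \<le> y k - aY * s k"
  shows "s k \<le> linear_decay_bound aY low up (s 0) k"
proof -
  have up: "0 < up" using assms by simp
  have "y k \<le> (1 - aY / up) ^ k * (up * s 0)"
  proof (induction k)
    case (Suc k)
    have "aY / up * y k \<le> aY / up * (up * s k)"
      using y(2)[of k] assms(1) up by (intro mult_left_mono) auto
    then have "y (Suc k) \<le> (1 - aY / up) * y k" using step[of k] up by (simp add: algebra_simps)
    also have "\<dots> \<le> (1 - aY / up) * ((1 - aY / up) ^ k * (up * s 0))"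
      using Suc assms up by (intro mult_left_mono) auto
    finally show ?case by simp
  qed (use y(2)[of 0] in simp)
  with y(1)[of k] have "low * s k \<le> (1 - aY / up) ^ k * (up * s 0)" by simp
  then show ?thesis using assms(3) by (simp add: linear_decay_bound_def field_simps)
qed

subsection \<open>Costs\<close>

lemma solution_Suc_shift:
  "solution f x u (Suc k) = solution f (f x (u 0)) (\<lambda>k. u (Suc k)) k"
  by (induction k) auto

lemma closed_loop_Suc_shift:
  "closed_loop f (Suc k) x h = closed_loop f k (f x (h x)) h"
  by (induction k) auto

lemma closed_loop_eq_solution:
  "solution f x (\<lambda>k. h (closed_loop f k x h)) k = closed_loop f k x h"
  by (induction k) auto

lemma policy_cost_eq_cost:
  "policy_cost f l x h = cost f l x (\<lambda>k. h (closed_loop f k x h))"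
  by (simp add: policy_cost_def cost_def closed_loop_eq_solution)

lemma admissible_closed_loop:
  "(\<And>x. h x \<in> U x) \<Longrightarrow> admissible f U x (\<lambda>k. h (closed_loop f k x h))"
  by (simp add: admissible_def closed_loop_eq_solution)

lemma Vstar_le_policy_cost:
  assumes "\<And>x. h x \<in> U x"
  shows "Vstar f U l x \<le> policy_cost f l x h"
  unfolding Vstar_def policy_cost_eq_cost
  using admissible_closed_loop[of h U f x, OF assms] by (auto intro: INF_lower)

context
  fixes f :: "'x \<Rightarrow> 'u \<Rightarrow> 'x" and l :: "'x \<Rightarrow> 'u \<Rightarrow> real"
  assumes l_nonneg: "\<And>x u. 0 \<le> l x u"
begin

lemma cost_nonneg: "0 \<le> cost f l x u"
  unfolding cost_def by (intro suminf_0_le) (auto simp: l_nonneg)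

lemma Vstar_nonneg: "0 \<le> Vstar f U l x"
  unfolding Vstar_def by (intro INF_greatest cost_nonneg)

lemma policy_cost_nonneg: "0 \<le> policy_cost f l x h"
  unfolding policy_cost_eq_cost by (rule cost_nonneg)

text \<open>Arguing with suprema of partial sums keeps the splitting valid for infinite
  costs.\<close>

lemma cost_step:
  "cost f l x u = ereal (l x (u 0)) + cost f l (f x (u 0)) (\<lambda>k. u (Suc k))"
proof -
  define t where "t k = ereal (l (solution f x u k) (u k))" for k
  have t: "0 \<le> t k" for k by (simp add: t_def l_nonneg)
  have tail: "cost f l (f x (u 0)) (\<lambda>k. u (Suc k)) = (\<Sum>k. t (Suc k))"
    unfolding cost_def t_def solution_Suc_shift ..
  have "(SUP n. \<Sum>k<n. t k) = t 0 + (SUP n. \<Sum>k<n. t (Suc k))"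
  proof (rule antisym)
    show "(SUP n. \<Sum>k<n. t k) \<le> t 0 + (SUP n. \<Sum>k<n. t (Suc k))"
    proof (rule SUP_least)
      fix n
      have "(\<Sum>k<n. t k) \<le> (\<Sum>k<Suc n. t k)"
        using t[of n] by (simp add: add_increasing2)
      also have "\<dots> = t 0 + (\<Sum>k<n. t (Suc k))" by (rule sum.lessThan_Suc_shift)
      also have "\<dots> \<le> t 0 + (SUP n. \<Sum>k<n. t (Suc k))" by (intro add_left_mono SUP_upper) simp
      finally show "(\<Sum>k<n. t k) \<le> t 0 + (SUP n. \<Sum>k<n. t (Suc k))" .
    qed
    have "t 0 \<noteq> -\<infinity>" by (simp add: t_def)
    then have "t 0 + (SUP n. \<Sum>k<n. t (Suc k)) = (SUP n. t 0 + (\<Sum>k<n. t (Suc k)))"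
      by (simp add: SUP_ereal_add_right)
    also have "\<dots> = (SUP n. \<Sum>k<Suc n. t k)" by (simp only: sum.lessThan_Suc_shift)
    also have "\<dots> \<le> (SUP n. \<Sum>k<n. t k)" by (rule SUP_mono) blast
    finally show "t 0 + (SUP n. \<Sum>k<n. t (Suc k)) \<le> (SUP n. \<Sum>k<n. t k)" .
  qed
  then have "(\<Sum>k. t k) = t 0 + (\<Sum>k. t (Suc k))"
    using t by (simp add: suminf_ereal_eq_SUP)
  then show ?thesis unfolding tail by (simp add: cost_def t_def)
qed

lemma policy_cost_step:
  "policy_cost f l x h = ereal (l x (h x)) + policy_cost f l (f x (h x)) h"
  unfolding policy_cost_eq_cost
  by (subst cost_step) (simp add: closed_loop_Suc_shift del: closed_loop.simps(2))

text \<open>Summing \<open>step\<close> along the closed loop telescopes; the remaining value of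
  \<open>V\<close> is nonnegative and is dropped.\<close>

lemma policy_cost_le:
  assumes V: "\<And>x. 0 \<le> V x" and step: "\<And>x. ereal (l x (h x)) + V (f x (h x)) \<le> V x"
  shows "policy_cost f l x h \<le> V x"
  unfolding policy_cost_def
proof (rule suminf_bound)
  let ?x = "\<lambda>k. closed_loop f k x h"
  have "(\<Sum>k<n. ereal (l (?x k) (h (?x k)))) + V (?x n) \<le> V x" for n
  proof (induction n)
    case (Suc n)
    have "(\<Sum>k<Suc n. ereal (l (?x k) (h (?x k)))) + V (?x (Suc n))
        = (\<Sum>k<n. ereal (l (?x k) (h (?x k)))) + (ereal (l (?x n) (h (?x n))) + V (f (?x n) (h (?x n))))"
      by (simp only: sum.lessThan_Suc closed_loop.simps add.assoc)
    also have "\<dots> \<le> (\<Sum>k<n. ereal (l (?x k) (h (?x k)))) + V (?x n)"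
      by (intro add_left_mono step)
    finally show ?case using Suc by (rule order_trans)
  qed simp
  then show "\<forall>n. (\<Sum>k<n. ereal (l (?x k) (h (?x k)))) \<le> V x"
    using V by (meson add_increasing2 order_refl order_trans)
qed (simp add: l_nonneg)

end

subsection \<open>Set-valued maps and functions with closed sublevel sets\<close>

lemma outer_semicontinuousD:
  assumes "outer_semicontinuous S" "X \<longlonglongrightarrow> x" "\<And>n. v n \<in> S (X n)" "v \<longlonglongrightarrow> u"
  shows "u \<in> S x"
  using assms(1)[unfolded outer_semicontinuous_def, rule_format, of X x v u] assms(2-) by blast

text \<open>Once \<open>X n\<close> is within \<open>\<delta> / 2\<close> of \<open>x\<close>, its
  ball of radius \<open>\<delta> / 2\<close> lies in the ball of radius \<open>\<delta>\<close>
  about \<open>x\<close>, so almost all \<open>v n\<close> lie in one closed set.\<close>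

lemma outer_semicontinuous_regularization:
  fixes S :: "'a::metric_space \<Rightarrow> 'b::first_countable_topology set"
  shows "outer_semicontinuous (regularization S)"
  unfolding outer_semicontinuous_def
proof (intro allI impI, elim conjE)
  fix X v x u
  assume X: "X \<longlonglongrightarrow> x" and v: "\<forall>n. v n \<in> regularization S (X n)" and u: "v \<longlonglongrightarrow> u"
  show "u \<in> regularization S x"
    unfolding regularization_def
  proof
    fix \<delta> :: real assume "\<delta> \<in> {0<..}"
    then have \<delta>: "0 < \<delta> / 2" by simp
    have "\<forall>\<^sub>F n in sequentially. v n \<in> closure (\<Union>y\<in>cball x \<delta>. S y)"
      using tendstoD[OF X \<delta>]
    proof eventually_elim
      case (elim n)
      have "dist x y \<le> \<delta>" if "dist (X n) y \<le> \<delta> / 2" for y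
        using elim that dist_triangle[of x y "X n"] by (simp add: dist_commute)
      then have "cball (X n) (\<delta> / 2) \<subseteq> cball x \<delta>" by auto
      then have "closure (\<Union>y\<in>cball (X n) (\<delta> / 2). S y) \<subseteq> closure (\<Union>y\<in>cball x \<delta>. S y)"
        by (intro closure_mono) blast
      with v \<delta> show ?case unfolding regularization_def by blast
    qed
    then show "u \<in> closure (\<Union>y\<in>cball x \<delta>. S y)"
      by (intro Lim_in_closed_set[OF closed_closure _ _ u]) auto
  qed
qed

lemma subset_regularization: "S x \<subseteq> regularization S x"
  unfolding regularization_def using closure_subset by fastforce

text \<open>Radius and accuracy \<open>inverse (Suc n)\<close> give points of the graph of
  \<open>S\<close> converging to \<open>(x, u)\<close>, and outer semicontinuity of \<open>U\<close>
  captures the limit. Hence regularized greedy inputs remain admissible.\<close>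

lemma regularization_subset:
  fixes S U :: "'a::metric_space \<Rightarrow> 'b::metric_space set"
  assumes U: "outer_semicontinuous U" and S: "\<And>y. S y \<subseteq> U y"
  shows "regularization S x \<subseteq> U x"
proof
  fix u assume u: "u \<in> regularization S x"
  have "\<exists>y w. dist y x \<le> inverse (Suc n) \<and> w \<in> S y \<and> dist w u < inverse (Suc n)" for n
  proof -
    have "u \<in> closure (\<Union>y\<in>cball x (inverse (Suc n)). S y)"
      using u unfolding regularization_def by auto
    moreover have "0 < inverse (real (Suc n))" by simp
    ultimately obtain w where "w \<in> (\<Union>y\<in>cball x (inverse (Suc n)). S y)" "dist w u < inverse (Suc n)"
      unfolding closure_approachable by blast
    then show ?thesis by (auto simp: dist_commute[of x])
  qed
  then obtain y w where yw: "\<And>n. dist (y n) x \<le> inverse (Suc n)" "\<And>n. w n \<in> S (y n)"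
    "\<And>n. dist (w n) u < inverse (Suc n)"
    by metis
  have lim: "z \<longlonglongrightarrow> z'" if "\<And>n. dist (z n) z' \<le> inverse (Suc n)"
    for z :: "nat \<Rightarrow> 'c::metric_space" and z'
    unfolding tendsto_dist_iff[of z]
    by (rule tendsto_sandwich[OF _ _ tendsto_const LIMSEQ_inverse_real_of_nat])
      (simp_all only: that zero_le_dist always_eventually simp_thms)
  have "y \<longlonglongrightarrow> x" "w \<longlonglongrightarrow> u"
    using yw(1) less_imp_le[OF yw(3)] by (blast intro: lim)+
  then show "u \<in> U x" using outer_semicontinuousD[OF U] S yw(2) by (metis subsetD)
qed

text \<open>Lower semicontinuity in a form that passes to suprema by intersection and can be checked
  on sequences.\<close>

definition closed_sublevels :: "('a::topological_space \<Rightarrow> ereal) \<Rightarrow> bool" where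
  "closed_sublevels V \<longleftrightarrow> (\<forall>c::real. closed {x. V x \<le> ereal c})"

lemma lower_semicontinuous_closed_sublevels:
  fixes V :: "'a::t2_space \<Rightarrow> ereal"
  assumes "lower_semicontinuous V"
  shows "closed_sublevels V"
  unfolding closed_sublevels_def
proof
  fix c :: real
  have "open {x. ereal c < V x}"
    unfolding open_subopen[of "{x. ereal c < V x}"]
  proof
    fix x assume x: "x \<in> {x. ereal c < V x}"
    then have "\<forall>\<^sub>F y in at x. ereal c < V y"
      using assms unfolding lower_semicontinuous_def le_Liminf_iff by auto
    \<comment> \<open>The filter \<open>at x\<close> omits \<open>x\<close> itself, which satisfies
      the inequality by choice.\<close>
    then have "\<forall>\<^sub>F y in nhds x. ereal c < V y"
      using x by (auto simp: eventually_at_filter elim: eventually_mono)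
    then show "\<exists>T. open T \<and> x \<in> T \<and> T \<subseteq> {x. ereal c < V x}"
      unfolding eventually_nhds by blast
  qed
  moreover have "- {x. ereal c < V x} = {x. V x \<le> ereal c}" by auto
  ultimately show "closed {x. V x \<le> ereal c}" by (metis closed_Compl)
qed

subsection \<open>Dynamic programming for a set-valued policy\<close>

definition policy_value ::
    "('x \<Rightarrow> 'u \<Rightarrow> 'x) \<Rightarrow> ('x \<Rightarrow> 'u \<Rightarrow> real) \<Rightarrow> ('x \<Rightarrow> 'u set) \<Rightarrow> 'x \<Rightarrow> ereal" where
  "policy_value f l S x = (INF h\<in>{h. selection S h}. policy_cost f l x h)"

text \<open>Starting from zero makes the iterates increase with the horizon, so that their limit is
  a supremum.\<close>

primrec value_iterate ::
    "('x \<Rightarrow> 'u \<Rightarrow> 'x) \<Rightarrow> ('x \<Rightarrow> 'u \<Rightarrow> real) \<Rightarrow> ('x \<Rightarrow> 'u set) \<Rightarrow> nat \<Rightarrow> 'x \<Rightarrow> ereal" where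
  "value_iterate f l S 0 = (\<lambda>x. 0)"
| "value_iterate f l S (Suc n) = (\<lambda>x. INF u\<in>S x. ereal (l x u) + value_iterate f l S n (f x u))"

locale level_bounded_system =
  fixes f :: "'x::metric_space \<Rightarrow> 'u::heine_borel \<Rightarrow> 'x" and l :: "'x \<Rightarrow> 'u \<Rightarrow> real"
  assumes l_nonneg: "0 \<le> l x u"
    and f_cont: "continuous_on UNIV (\<lambda>(x, u). f x u)"
    and l_cont: "continuous_on UNIV (\<lambda>(x, u). l x u)"
    and l_level: "level_bounded l"
begin

text \<open>The only compactness argument: it yields existence of minimizers, closedness of the sublevel
  sets of value functions, and the Bellman equation for the limit of value iteration.\<close>

lemma exists_limit_input:
  assumes S: "outer_semicontinuous S"
    and V: "\<And>n. closed_sublevels (V n)" "\<And>n x. 0 \<le> V n x" "\<And>x. incseq (\<lambda>n. V n x)"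
    and X: "X \<longlonglongrightarrow> x" and v: "\<And>n. v n \<in> S (X n)"
    and c: "c \<longlonglongrightarrow> c'" and le: "\<And>n. ereal (l (X n) (v n)) + V n (f (X n) (v n)) \<le> ereal (c n)"
  shows "\<exists>u\<in>S x. ereal (l x u) + (SUP n. V n (f x u)) \<le> ereal c'"
proof -
  have "Bseq c" using c by (intro convergent_imp_Bseq convergentI)
  then obtain M where M: "\<And>n. c n \<le> M" unfolding Bseq_def by (metis abs_le_D1 real_norm_def)
  obtain T B where T: "open T" "x \<in> T" and B: "bounded B" "\<And>z u. z \<in> T \<Longrightarrow> l z u \<le> M \<Longrightarrow> u \<in> B"
    using l_level unfolding level_bounded_def by (metis (mono_tags, lifting) mem_Collect_eq subsetD)
  have lV: "ereal (l (X n) (v n)) \<le> ereal (c n)" for n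
    using le[of n] V(2)[of n "f (X n) (v n)"] by (meson add_increasing2 order_refl order_trans)
  have lM: "l (X n) (v n) \<le> M" for n using lV[of n] M[of n] by simp
  \<comment> \<open>Level-boundedness is local in the state, so the finitely many states outside
    \<open>T\<close> are skipped by an index shift.\<close>
  obtain n0 where n0: "\<And>n. n \<ge> n0 \<Longrightarrow> X n \<in> T"
    using topological_tendstoD[OF X T] unfolding eventually_sequentially by blast
  have "range (\<lambda>n. v (n + n0)) \<subseteq> B"
    using B(2)[OF n0 lM] by auto
  then have "bounded (range (\<lambda>n. v (n + n0)))" using B(1) bounded_subset by blast
  then obtain u r where r: "strict_mono r" and u': "((\<lambda>n. v (n + n0)) \<circ> r) \<longlonglongrightarrow> u"
    using bounded_imp_convergent_subsequence by blast
  define s where "s n = r n + n0" for n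
  have s: "filterlim s sequentially sequentially"
    unfolding s_def using filterlim_subseq[OF r]
    by (rule filterlim_at_top_mono) simp
  have u: "(\<lambda>n. v (s n)) \<longlonglongrightarrow> u" using u' by (simp add: comp_def s_def)
  have Xs: "(\<lambda>n. X (s n)) \<longlonglongrightarrow> x" and cs: "(\<lambda>n. c (s n)) \<longlonglongrightarrow> c'"
    using filterlim_compose[OF X s] filterlim_compose[OF c s] by auto
  have "u \<in> S x" using outer_semicontinuousD[OF S Xs v u] .
  have fs: "(\<lambda>n. f (X (s n)) (v (s n))) \<longlonglongrightarrow> f x u"
    using continuous_on_tendsto_compose[OF f_cont tendsto_Pair[OF Xs u]] by simp
  have ls: "(\<lambda>n. l (X (s n)) (v (s n))) \<longlonglongrightarrow> l x u"
    using continuous_on_tendsto_compose[OF l_cont tendsto_Pair[OF Xs u]] by simp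
  \<comment> \<open>With \<open>N\<close> fixed, \<open>V N\<close> eventually lies below
    \<open>V (s n)\<close>. The slack \<open>e\<close> replaces the converging levels by one
    constant, so closedness of a single sublevel set of \<open>V N\<close> applies; the supremum
    over \<open>N\<close> comes last.\<close>
  have "V N (f x u) \<le> ereal (c' - l x u)" for N
  proof (rule ereal_le_epsilon2)
    fix e :: real assume e: "0 < e"
    have "(\<lambda>n. c (s n) - l (X (s n)) (v (s n))) \<longlonglongrightarrow> c' - l x u"
      by (intro tendsto_diff cs ls)
    then have "\<forall>\<^sub>F n in sequentially. c (s n) - l (X (s n)) (v (s n)) < c' - l x u + e"
      by (rule order_tendstoD) (use e in simp)
    moreover have "\<forall>\<^sub>F n in sequentially. N \<le> s n"
      using s unfolding filterlim_at_top by blast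
    ultimately have "\<forall>\<^sub>F n in sequentially.
        f (X (s n)) (v (s n)) \<in> {z. V N z \<le> ereal (c' - l x u + e)}"
    proof eventually_elim
      case (elim n)
      let ?z = "f (X (s n)) (v (s n))"
      have "V N ?z \<le> V (s n) ?z" using incseqD[OF V(3) elim(2)] .
      also have "\<dots> \<le> ereal (c (s n) - l (X (s n)) (v (s n)))"
        using le[of "s n"] by (cases "V (s n) ?z") auto
      finally show ?case using elim(1) by (auto elim: order_trans)
    qed
    then have "f x u \<in> {z. V N z \<le> ereal (c' - l x u + e)}"
      using V(1)[of N] unfolding closed_sublevels_def
      by (intro Lim_in_closed_set[OF _ _ _ fs]) auto
    then show "V N (f x u) \<le> ereal (c' - l x u) + ereal e" by simp
  qed
  then have "(SUP n. V n (f x u)) \<le> ereal (c' - l x u)" by (intro SUP_least)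
  then have "ereal (l x u) + (SUP n. V n (f x u)) \<le> ereal (l x u) + ereal (c' - l x u)"
    by (rule add_left_mono)
  with \<open>u \<in> S x\<close> show ?thesis by auto
qed

text \<open>\<open>exists_limit_input\<close> is applied to a minimizing sequence, with constant
  state and a constant family of functions.\<close>

lemma exists_minimizing_input:
  assumes S: "outer_semicontinuous S" "S x \<noteq> {}" and V: "closed_sublevels V" "\<And>x. 0 \<le> V x"
  shows "\<exists>u\<in>S x. ereal (l x u) + V (f x u) = (INF w\<in>S x. ereal (l x w) + V (f x w))"
proof -
  let ?m = "INF w\<in>S x. ereal (l x w) + V (f x w)"
  have "0 \<le> ?m" by (intro INF_greatest add_nonneg_nonneg V) (simp add: l_nonneg)
  have "\<exists>u\<in>S x. ereal (l x u) + V (f x u) \<le> ?m"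
  proof (cases ?m)
    case (real m)
    have "\<exists>w\<in>S x. ereal (l x w) + V (f x w) \<le> ereal (m + inverse (Suc n))" for n
    proof -
      have "?m < ereal (m + inverse (Suc n))" unfolding real by simp
      then show ?thesis unfolding INF_less_iff by (auto intro: less_imp_le)
    qed
    then obtain w where w: "\<And>n. w n \<in> S x"
      "\<And>n. ereal (l x (w n)) + V (f x (w n)) \<le> ereal (m + inverse (Suc n))"
      by metis
    have "(\<lambda>n. m + inverse (real (Suc n))) \<longlonglongrightarrow> m"
      using tendsto_add[OF tendsto_const LIMSEQ_inverse_real_of_nat] by simp
    from exists_limit_input[OF S(1) V(1,2) _ tendsto_const w(1) this w(2)] show ?thesis
      unfolding real by (simp add: incseq_def)
  qed (use S(2) \<open>0 \<le> ?m\<close> in auto)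
  then show ?thesis by (auto intro!: bexI antisym INF_lower)
qed

context
  fixes S :: "'x \<Rightarrow> 'u set"
  assumes S_osc: "outer_semicontinuous S" and S_nonempty: "\<And>x. S x \<noteq> {}"
begin

private abbreviation "vi \<equiv> value_iterate f l S"

lemma value_iterate_nonneg: "0 \<le> vi n x"
proof (induction n arbitrary: x)
  case (Suc n)
  then show ?case by (auto intro!: INF_greatest add_nonneg_nonneg simp: l_nonneg)
qed simp

lemma value_iterate_incseq: "incseq (\<lambda>n. vi n x)"
proof (rule incseq_SucI)
  show "vi n x \<le> vi (Suc n) x" for n
  proof (induction n arbitrary: x)
    case 0
    then show ?case using value_iterate_nonneg[of 1 x] by simp
  next
    case (Suc n)
    have "(INF u\<in>S x. ereal (l x u) + vi n (f x u)) \<le> (INF u\<in>S x. ereal (l x u) + vi (Suc n) (f x u))"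
      using Suc by (intro INF_superset_mono order_refl add_left_mono)
    then show ?case by simp
  qed
qed

lemma closed_sublevels_value_iterate: "closed_sublevels (vi n)"
proof (induction n)
  case 0
  show ?case by (simp add: closed_sublevels_def)
next
  case (Suc n)
  show ?case
    unfolding closed_sublevels_def closed_sequential_limits
  proof (intro allI impI, elim conjE)
    fix c X x
    assume X: "\<forall>k. X k \<in> {x. vi (Suc n) x \<le> ereal c}" "X \<longlonglongrightarrow> x"
    have "\<exists>u\<in>S (X k). ereal (l (X k) u) + vi n (f (X k) u) \<le> ereal c" for k
      using exists_minimizing_input[OF S_osc S_nonempty Suc value_iterate_nonneg, of "X k"] X(1)
      by (metis mem_Collect_eq value_iterate.simps(2))
    then obtain v where v: "\<And>k. v k \<in> S (X k)"
      "\<And>k. ereal (l (X k) (v k)) + vi n (f (X k) (v k)) \<le> ereal c"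
      by metis
    obtain u where "u \<in> S x" "ereal (l x u) + vi n (f x u) \<le> ereal c"
      using exists_limit_input[OF S_osc Suc value_iterate_nonneg _ X(2) v(1) tendsto_const v(2)]
      by (auto simp: incseq_def)
    then show "x \<in> {x. vi (Suc n) x \<le> ereal c}" by (auto intro: INF_lower2)
  qed
qed

text \<open>Minimizers for all horizons share the bound \<open>r\<close>, so they accumulate at one
  input that is good for every horizon. This interchanges the minimum over inputs with the supremum
  over horizons.\<close>

lemma SUP_value_iterate_decrease:
  "\<exists>u\<in>S x. ereal (l x u) + (SUP n. vi n (f x u)) \<le> (SUP n. vi n x)"
proof (cases "SUP n. vi n x")
  case (real r)
  have "\<exists>u\<in>S x. ereal (l x u) + vi n (f x u) \<le> ereal r" for n
  proof -
    have "vi (Suc n) x \<le> ereal r" unfolding real[symmetric] by (rule SUP_upper) simp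
    moreover obtain u where "u \<in> S x" "ereal (l x u) + vi n (f x u) = vi (Suc n) x"
      using exists_minimizing_input[OF S_osc S_nonempty closed_sublevels_value_iterate value_iterate_nonneg,
          of x n] by auto
    ultimately show ?thesis by (intro bexI[of _ u]) (simp_all only:)
  qed
  then obtain v where v: "\<And>n. v n \<in> S x" "\<And>n. ereal (l x (v n)) + vi n (f x (v n)) \<le> ereal r"
    by metis
  show ?thesis
    unfolding real
    by (rule exists_limit_input[OF S_osc closed_sublevels_value_iterate value_iterate_nonneg
          value_iterate_incseq tendsto_const v(1) tendsto_const v(2)])
next
  case MInf
  then show ?thesis using value_iterate_nonneg[of 0 x] SUP_upper[of 0 UNIV "\<lambda>n. vi n x"] by auto
qed (use S_nonempty in auto)

text \<open>A policy following the inputs of \<open>SUP_value_iterate_decrease\<close> costs at most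
  the supremum, by telescoping. Conversely, every selection pays at least each finite-horizon
  value.\<close>

lemma policy_value_eq_SUP: "policy_value f l S x = (SUP n. vi n x)"
proof (rule antisym)
  have nonneg: "0 \<le> (SUP n. vi n x)" for x
    using value_iterate_nonneg by (intro SUP_upper2[of 0]) auto
  obtain h where h: "\<And>x. h x \<in> S x"
    "\<And>x. ereal (l x (h x)) + (SUP n. vi n (f x (h x))) \<le> (SUP n. vi n x)"
    using SUP_value_iterate_decrease by metis
  have "policy_value f l S x \<le> policy_cost f l x h"
    unfolding policy_value_def using h(1) by (intro INF_lower) (simp add: selection_def)
  also have "\<dots> \<le> (SUP n. vi n x)"
    by (rule policy_cost_le[where V = "\<lambda>x. SUP n. vi n x"]) (use l_nonneg nonneg h(2) in auto)
  finally show "policy_value f l S x \<le> (SUP n. vi n x)" .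
  have "vi n x \<le> policy_cost f l x h" if h: "selection S h" for h n
  proof (induction n arbitrary: x)
    case 0
    then show ?case by (simp add: policy_cost_nonneg l_nonneg)
  next
    case (Suc n)
    have "vi (Suc n) x \<le> ereal (l x (h x)) + vi n (f x (h x))"
      using h S_nonempty by (auto simp: selection_def intro: INF_lower)
    also have "\<dots> \<le> policy_cost f l x h"
      unfolding policy_cost_step[of l f x h, OF l_nonneg] by (intro add_left_mono Suc)
    finally show ?case .
  qed
  then show "(SUP n. vi n x) \<le> policy_value f l S x"
    unfolding policy_value_def by (intro SUP_least INF_greatest) auto
qed

lemma closed_sublevels_policy_value: "closed_sublevels (policy_value f l S)"
proof -
  have "{x. policy_value f l S x \<le> ereal c} = (\<Inter>n. {x. vi n x \<le> ereal c})" for c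
    by (auto simp: policy_value_eq_SUP SUP_le_iff)
  then show ?thesis
    using closed_sublevels_value_iterate by (auto simp: closed_sublevels_def)
qed

lemma policy_value_decrease:
  "\<exists>u\<in>S x. ereal (l x u) + policy_value f l S (f x u) \<le> policy_value f l S x"
  using SUP_value_iterate_decrease by (simp add: policy_value_eq_SUP)

lemma policy_value_nonneg: "0 \<le> policy_value f l S x"
  unfolding policy_value_def by (intro INF_greatest policy_cost_nonneg l_nonneg)

end

end

subsection \<open>The algorithm\<close>

lemma greedy_inputs_iff:
  "u \<in> greedy_inputs f U l V x \<longleftrightarrow>
    u \<in> U x \<and> (\<forall>w\<in>U x. ereal (l x u) + V (f x u) \<le> ereal (l x w) + V (f x w))"
  by (auto simp: greedy_inputs_def is_arg_min_linorder)

locale pi_plus = level_bounded_system f l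
  for f :: "'x::metric_space \<Rightarrow> 'u::heine_borel \<Rightarrow> 'x" and l :: "'x \<Rightarrow> 'u \<Rightarrow> real" +
  fixes U :: "'x \<Rightarrow> 'u set" and h0 :: "'x \<Rightarrow> 'u"
  assumes U_osc: "outer_semicontinuous U"
    and h0: "h0 x \<in> U x"
    and optimal: "\<exists>u. admissible f U x u \<and> cost f l x u = Vstar f U l x \<and> cost f l x u < \<infinity>"
    and V0_lsc: "lower_semicontinuous (V_r f U l h0 0)"
    and V0_finite: "policy_cost f l x h0 < \<infinity>"
begin

abbreviation "V \<equiv> V_r f U l h0"
abbreviation "Vs \<equiv> Vstar f U l"

lemma U_nonempty: "U x \<noteq> {}"
  using h0 by blast

context
  fixes V' :: "'x \<Rightarrow> ereal"
  assumes V': "closed_sublevels V'" "\<And>x. 0 \<le> V' x"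
    "\<And>x. \<exists>u\<in>U x. ereal (l x u) + V' (f x u) \<le> V' x"
begin

private abbreviation "S \<equiv> regularization (greedy_inputs f U l V')"

lemma greedy_inputs_nonempty: "greedy_inputs f U l V' x \<noteq> {}"
proof -
  obtain u where "u \<in> U x"
    and u: "ereal (l x u) + V' (f x u) = (INF w\<in>U x. ereal (l x w) + V' (f x w))"
    using exists_minimizing_input[OF U_osc U_nonempty V'(1,2)] by blast
  then have "u \<in> greedy_inputs f U l V' x"
    unfolding greedy_inputs_iff u by (blast intro: INF_lower)
  then show ?thesis by blast
qed

lemma regularized_greedy_nonempty: "S x \<noteq> {}"
  using greedy_inputs_nonempty[of x] subset_regularization[of "greedy_inputs f U l V'" x] by blast

text \<open>The hypotheses on \<open>V'\<close> pass to the value after a greedy step; this is the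
  induction step of \<open>V_r_invariant\<close>.\<close>

lemma improved_value:
  "closed_sublevels (policy_value f l S)" "0 \<le> policy_value f l S x"
  "\<exists>u\<in>U x. ereal (l x u) + policy_value f l S (f x u) \<le> policy_value f l S x"
proof -
  note S = outer_semicontinuous_regularization regularized_greedy_nonempty
  show "closed_sublevels (policy_value f l S)" by (rule closed_sublevels_policy_value[OF S])
  show "0 \<le> policy_value f l S x" by (rule policy_value_nonneg[OF S])
  have "S x \<subseteq> U x"
    by (rule regularization_subset[OF U_osc]) (auto simp: greedy_inputs_iff)
  then show "\<exists>u\<in>U x. ereal (l x u) + policy_value f l S (f x u) \<le> policy_value f l S x"
    using policy_value_decrease[OF S, of x] by blast
qed

text \<open>Some input decreases \<open>V'\<close>, hence the greedy \<open>h\<close> does too and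
  costs at most \<open>V'\<close>. Using that bound only after the first step leaves
  \<open>l x (h x) + V' (f x (h x))\<close>, which greediness minimizes over
  \<open>U x\<close>.\<close>

lemma policy_improvement:
  assumes u: "u \<in> U x"
  shows "policy_value f l S x \<le> ereal (l x u) + V' (f x u)"
proof -
  have "\<exists>u. u \<in> greedy_inputs f U l V' x" for x using greedy_inputs_nonempty by blast
  then obtain h where h: "\<And>x. h x \<in> greedy_inputs f U l V' x" by metis
  have "h x \<in> S x" for x using h subset_regularization by blast
  then have "policy_value f l S x \<le> policy_cost f l x h"
    unfolding policy_value_def by (intro INF_lower) (simp add: selection_def)
  also have "\<dots> = ereal (l x (h x)) + policy_cost f l (f x (h x)) h"
    by (rule policy_cost_step[of l, OF l_nonneg])
  also have "policy_cost f l (f x (h x)) h \<le> V' (f x (h x))"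
  proof (rule policy_cost_le[of l V', OF l_nonneg V'(2)])
    fix x
    obtain w where "w \<in> U x" "ereal (l x w) + V' (f x w) \<le> V' x" using V'(3) by blast
    then show "ereal (l x (h x)) + V' (f x (h x)) \<le> V' x"
      using h[of x] unfolding greedy_inputs_iff by (blast intro: order_trans)
  qed
  also have "ereal (l x (h x)) + V' (f x (h x)) \<le> ereal (l x u) + V' (f x u)"
    using h[of x] u unfolding greedy_inputs_iff by blast
  finally show ?thesis by (simp add: add_left_mono)
qed

end

lemma V_r_Suc: "V (Suc i) = policy_value f l (regularization (greedy_inputs f U l (V i)))"
  by (simp add: policy_value_def fun_eq_iff)

lemma V_r_invariant:
  "closed_sublevels (V i) \<and> (\<forall>x. 0 \<le> V i x) \<and> (\<forall>x. \<exists>u\<in>U x. ereal (l x u) + V i (f x u) \<le> V i x)"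
proof (induction i)
  case 0
  have "\<exists>u\<in>U x. ereal (l x u) + V 0 (f x u) \<le> V 0 x" for x
    using policy_cost_step[of l f x h0, OF l_nonneg] h0[of x] by (auto intro!: bexI[of _ "h0 x"])
  then show ?case
    using lower_semicontinuous_closed_sublevels[OF V0_lsc] policy_cost_nonneg[of l f, OF l_nonneg]
    by simp
next
  case (Suc i)
  then have V: "closed_sublevels (V i)" "\<And>x. 0 \<le> V i x"
    "\<And>x. \<exists>u\<in>U x. ereal (l x u) + V i (f x u) \<le> V i x"
    by simp_all
  show ?case unfolding V_r_Suc by (intro conjI allI improved_value V)
qed

lemmas V_r_closed_sublevels = V_r_invariant[THEN conjunct1]
  and V_r_nonneg = V_r_invariant[THEN conjunct2, THEN conjunct1, rule_format]
  and V_r_decrease = V_r_invariant[THEN conjunct2, THEN conjunct2, rule_format]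

lemma V_r_Suc_le: "u \<in> U x \<Longrightarrow> V (Suc i) x \<le> ereal (l x u) + V i (f x u)"
  unfolding V_r_Suc
  by (rule policy_improvement[OF V_r_closed_sublevels V_r_nonneg V_r_decrease])

text \<open>The iterates are nonincreasing in \<open>i\<close>, so finiteness is inherited from the
  initial policy.\<close>

lemma V_r_finite: "V i x < \<infinity>"
proof (induction i)
  case 0
  show ?case using V0_finite by simp
next
  case (Suc i)
  obtain u where "u \<in> U x" "ereal (l x u) + V i (f x u) \<le> V i x" using V_r_decrease by blast
  then have "V (Suc i) x \<le> V i x" using V_r_Suc_le order_trans by blast
  with Suc show ?case by (rule le_less_trans[rotated])
qed

lemma Vstar_finite: "Vs x < \<infinity>"
  using optimal by metis

lemma Vstar_le_step:
  assumes "u \<in> U x"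
  shows "Vs x \<le> ereal (l x u) + Vs (f x u)"
proof -
  obtain w where w: "admissible f U (f x u) w" "cost f l (f x u) w = Vs (f x u)"
    using optimal by blast
  let ?w = "case_nat u w"
  have "?w k \<in> U (solution f x ?w k)" for k
    using assms w(1) by (cases k) (auto simp: solution_Suc_shift admissible_def simp del: solution.simps(2))
  then have "admissible f U x ?w" by (simp add: admissible_def)
  then have "Vs x \<le> cost f l x ?w" unfolding Vstar_def by (intro INF_lower) simp
  also have "\<dots> = ereal (l x u) + Vs (f x u)" using w(2) by (subst cost_step) (auto simp: l_nonneg)
  finally show ?thesis .
qed

lemma Vstar_step_attained: "\<exists>u\<in>U x. ereal (l x u) + Vs (f x u) \<le> Vs x"
proof -
  obtain w where w: "admissible f U x w" "cost f l x w = Vs x" using optimal by blast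
  have "admissible f U (f x (w 0)) (\<lambda>k. w (Suc k))"
    using w(1) unfolding admissible_def solution_Suc_shift[symmetric] by blast
  then have "Vs (f x (w 0)) \<le> cost f l (f x (w 0)) (\<lambda>k. w (Suc k))"
    unfolding Vstar_def by (intro INF_lower) simp
  then have "ereal (l x (w 0)) + Vs (f x (w 0)) \<le> Vs x"
    unfolding w(2)[symmetric] cost_step[of l f x w, OF l_nonneg] by (rule add_left_mono)
  moreover have "w 0 \<in> U x" using w(1) unfolding admissible_def by (metis solution.simps(1))
  ultimately show ?thesis by blast
qed

text \<open>\<open>selection\<close> says nothing where a map is empty; this makes it constrain
  \<open>hstar\<close> at every state.\<close>

lemma Hstar_nonempty: "Hstar f U l x \<noteq> {}"
proof -
  obtain u where "u \<in> U x" "ereal (l x u) + Vs (f x u) \<le> Vs x" using Vstar_step_attained by blast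
  then have "u \<in> Hstar f U l x"
    unfolding Hstar_def greedy_inputs_iff using Vstar_le_step by (blast intro: order_trans)
  then show ?thesis by blast
qed

section \<open>The gap along an optimal closed loop\<close>

context
  fixes hstar
  assumes hstar: "selection (Hstar f U l) hstar"
begin

lemma hstar_greedy: "hstar x \<in> greedy_inputs f U l Vs x"
  using hstar Hstar_nonempty unfolding selection_def Hstar_def by blast

lemma hstar_in_U: "hstar x \<in> U x"
  using hstar_greedy by (simp add: greedy_inputs_iff)

lemma Vstar_hstar: "Vs x = ereal (l x (hstar x)) + Vs (f x (hstar x))"
proof (rule antisym)
  obtain u where "u \<in> U x" "ereal (l x u) + Vs (f x u) \<le> Vs x" using Vstar_step_attained by blast
  then show "ereal (l x (hstar x)) + Vs (f x (hstar x)) \<le> Vs x"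
    using hstar_greedy[of x] unfolding greedy_inputs_iff by (blast intro: order_trans)
qed (intro Vstar_le_step hstar_in_U)

lemma V_r_minus_Vstar_le:
  "V i x - Vs x \<le> V 0 (closed_loop f i x hstar) - Vs (closed_loop f i x hstar)"
proof (induction i arbitrary: x)
  case (Suc i)
  let ?y = "f x (hstar x)"
  have "V (Suc i) x \<le> ereal (l x (hstar x)) + V i ?y" by (intro V_r_Suc_le hstar_in_U)
  \<comment> \<open>The Bellman equation for \<open>hstar\<close> cancels the stage cost; finiteness
    and nonnegativity rule out undefined differences.\<close>
  then have "V (Suc i) x - Vs x \<le> V i ?y - Vs ?y"
    using Vstar_hstar[of x] V_r_finite[of i ?y] Vstar_finite[of ?y] V_r_nonneg[of i ?y]
      Vstar_nonneg[of l f U ?y, OF l_nonneg] V_r_nonneg[of "Suc i" x]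
    by (cases "V i ?y"; cases "Vs ?y"; cases "V (Suc i) x") auto
  also note Suc[of ?y]
  finally show ?case unfolding closed_loop_Suc_shift .
qed simp

end

end

subsection \<open>Lyapunov functions for the optimal closed loop\<close>

text \<open>\<open>F\<close> is the optimal closed loop, \<open>v\<close> the optimal value and \<open>r\<close> the optimal stage cost.\<close>

locale detectable_descent =
  fixes F :: "'x \<Rightarrow> 'x" and \<sigma> v W r :: "'x \<Rightarrow> real" and aW \<chi>W bW bV :: "real \<Rightarrow> real"
  assumes \<sigma>_nonneg: "0 \<le> \<sigma> x" and r_nonneg: "0 \<le> r x" and v_nonneg: "0 \<le> v x"
    and W_nonneg: "0 \<le> W x"
    and v_step: "v (F x) = v x - r x" and v_le: "v x \<le> bV (\<sigma> x)"
    and W_step: "W (F x) - W x \<le> - aW (\<sigma> x) + \<chi>W (r x)" and W_le: "W x \<le> bW (\<sigma> x)"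
    and aW: "class_Kinf aW" and \<chi>W: "class_Kinf \<chi>W" and bV: "class_Kinf bV"
    and bW_cont: "continuous_on {0..} bW" and bW_mono: "mono_on {0..} bW" and bW_zero: "bW 0 = 0"
begin

lemma r_le_v: "r x \<le> v x"
  using v_nonneg[of "F x"] v_step[of x] by simp

lemma \<chi>W_r_ge: "aW (\<sigma> x) - W x \<le> \<chi>W (r x)"
  using W_step[of x] W_nonneg[of "F x"] by simp

text \<open>The function inverted in \<open>q_W\<close>. If \<open>\<chi>W (r x)\<close> exceeds
  \<open>aW (\<sigma> x) / 2\<close>, then \<open>W x + \<chi>W (r x)\<close> is at most
  \<open>\<theta> (r x)\<close>, which \<open>q_W\<close> sends to \<open>r x / 2\<close>.\<close>

definition "\<theta> t = \<chi>W t + (bW (Kinv aW (2 * \<chi>W t)) + Kinv aW (2 * \<chi>W t))"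

lemma q_W_eq: "q_W aW \<chi>W bW = (\<lambda>s. 1/2 * Kinv \<theta> s)"
  unfolding q_W_def \<theta>_def by simp

lemma class_Kinf_Kinv_aW_\<chi>W: "class_Kinf (\<lambda>t. Kinv aW (2 * \<chi>W t))"
  by (rule class_Kinf_compose[OF class_Kinf_Kinv[OF aW] class_Kinf_compose[OF class_Kinf_linear \<chi>W]]) simp

lemma class_Kinf_\<theta>: "class_Kinf \<theta>"
proof -
  let ?k = "\<lambda>t. Kinv aW (2 * \<chi>W t)"
  note k = class_Kinf_Kinv_aW_\<chi>W
  have "class_Kinf (\<lambda>t. ?k t + bW (?k t))"
  proof (rule class_Kinf_add[OF k])
    show "continuous_on {0..} (\<lambda>t. bW (?k t))"
      using class_Kinf_nonneg[OF k]
      by (intro continuous_on_compose2[OF bW_cont class_Kinf_continuous[OF k]]) auto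
    show "mono_on {0..} (\<lambda>t. bW (?k t))"
      using class_Kinf_nonneg[OF k] class_Kinf_mono[OF k]
      by (intro mono_onI mono_onD[OF bW_mono]) auto
    show "bW (?k 0) = 0" using class_Kinf_zero[OF k] by (simp add: bW_zero)
  qed
  then have k': "class_Kinf (\<lambda>t. bW (?k t) + ?k t)" by (simp add: add.commute)
  show ?thesis
    unfolding \<theta>_def[abs_def]
    by (rule class_Kinf_add[OF \<chi>W class_Kinf_continuous[OF k'] class_Kinf_mono_on[OF k'] class_Kinf_zero[OF k']])
qed

lemma class_Kinf_q_W: "class_Kinf (q_W aW \<chi>W bW)"
  unfolding q_W_eq by (rule class_Kinf_compose[OF class_Kinf_linear class_Kinf_Kinv[OF class_Kinf_\<theta>]]) simp

lemma class_Kinf_q_V: "class_Kinf (q_V \<chi>W)"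
  unfolding q_V_def[abs_def]
  by (rule class_Kinf_compose[OF class_Kinf_linear class_Kinf_compose[OF \<chi>W class_Kinf_linear]]) simp_all

lemma class_Kinf_rho_W: "class_Kinf (rho_W aW \<chi>W bW)"
  unfolding rho_W_def[abs_def] by (rule class_Kinf_integral[OF class_Kinf_q_W])

lemma class_Kinf_rho_V: "class_Kinf (rho_V \<chi>W)"
  unfolding rho_V_def[abs_def] by (rule class_Kinf_integral[OF class_Kinf_q_V])

text \<open>Only the upper half \<open>[v x - r x / 2, v x]\<close> of the integration interval is
  counted. There twice the argument is at least \<open>r x\<close>, because
  \<open>r x \<le> v x\<close>, so the integrand is at least
  \<open>2 * \<chi>W (r x)\<close>.\<close>

lemma rho_V_decrease: "rho_V \<chi>W (v x - r x) - rho_V \<chi>W (v x) \<le> - (r x * \<chi>W (r x))"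
proof -
  note r = r_nonneg[of x] r_le_v[of x]
  have "\<chi>W (r x) \<le> \<chi>W (2 * (v x - r x / 2))"
    using r by (intro class_Kinf_mono[OF \<chi>W]) auto
  then have "r x * \<chi>W (r x) \<le> r x * \<chi>W (2 * (v x - r x / 2))"
    using r by (intro mult_left_mono) auto
  also have "\<dots> = q_V \<chi>W (v x - r x / 2) * (v x - (v x - r x / 2))"
    by (simp add: q_V_def)
  also have "\<dots> \<le> rho_V \<chi>W (v x) - rho_V \<chi>W (v x - r x / 2)"
    unfolding rho_V_def using r by (intro integral_class_Kinf_bounds(1)[OF class_Kinf_q_V]) auto
  also have "\<dots> \<le> rho_V \<chi>W (v x) - rho_V \<chi>W (v x - r x)"
    using r class_Kinf_mono[OF class_Kinf_rho_V, of "v x - r x" "v x - r x / 2"] by simp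
  finally show ?thesis by simp
qed

lemma Y_decrease:
  "rho_V \<chi>W (v (F x)) + rho_W aW \<chi>W bW (W (F x))
    \<le> rho_V \<chi>W (v x) + rho_W aW \<chi>W bW (W x) - alpha_Y aW \<chi>W bW (\<sigma> x)"
proof -
  let ?q = "q_W aW \<chi>W bW" and ?\<rho> = "rho_W aW \<chi>W bW"
  define A L where "A = aW (\<sigma> x)" and "L = \<chi>W (r x)"
  note q_mono = class_Kinf_mono[OF class_Kinf_q_W] and \<rho>_mono = class_Kinf_mono[OF class_Kinf_rho_W]
  have A: "0 \<le> A" and L: "0 \<le> L"
    using class_Kinf_nonneg[OF aW \<sigma>_nonneg] class_Kinf_nonneg[OF \<chi>W r_nonneg] by (auto simp: A_def L_def)
  have W': "W (F x) \<le> W x - A + L" using W_step[of x] by (simp add: A_def L_def)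
  have V: "rho_V \<chi>W (v (F x)) - rho_V \<chi>W (v x) \<le> - (r x * L)"
    unfolding v_step L_def by (rule rho_V_decrease)
  have alpha: "alpha_Y aW \<chi>W bW (\<sigma> x) = ?q (A / 4) * (A / 4)"
    by (simp add: alpha_Y_def A_def)
  show ?thesis
  proof (cases "L \<le> A / 2")
    case True
    \<comment> \<open>Small stage cost: \<open>W\<close> drops by at least \<open>A / 2\<close>. On
      the piece \<open>[W x - A / 4, W x]\<close> of the drop the weight is at least
      \<open>?q (A / 4)\<close>, which yields \<open>alpha_Y\<close>.\<close>
    have WA: "W (F x) \<le> W x - A / 2" "A / 2 \<le> W x"
      using True W' W_nonneg[of "F x"] by auto
    have "?q (A / 4) * (A / 4) \<le> ?q (W x - A / 4) * (A / 4)"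
      using A WA by (intro mult_right_mono q_mono) auto
    also have "\<dots> = ?q (W x - A / 4) * (W x - (W x - A / 4))" by simp
    also have "\<dots> \<le> ?\<rho> (W x) - ?\<rho> (W x - A / 4)"
      unfolding rho_W_def using A WA by (intro integral_class_Kinf_bounds(1)[OF class_Kinf_q_W]) auto
    also have "\<dots> \<le> ?\<rho> (W x) - ?\<rho> (W (F x))"
      using A WA W_nonneg[of "F x"] by (intro diff_left_mono \<rho>_mono) auto
    finally have "?q (A / 4) * (A / 4) \<le> ?\<rho> (W x) - ?\<rho> (W (F x))" .
    moreover have "0 \<le> r x * L" using r_nonneg L by simp
    ultimately show ?thesis using V alpha by linarith
  next
    case False
    \<comment> \<open>Large stage cost: \<open>L\<close> controls \<open>\<sigma> x\<close> and
      hence \<open>W x\<close>. The decrease \<open>r x * L\<close> of the \<open>rho_V\<close> part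
      pays \<open>r x / 2 * L\<close> twice, for a possible growth of the \<open>rho_W\<close> part
      and for \<open>alpha_Y\<close>.\<close>
    have "\<sigma> x \<le> Kinv aW (2 * L)"
      using False A L Kinv_left[OF aW \<sigma>_nonneg, of x]
        class_Kinf_mono[OF class_Kinf_Kinv[OF aW], of A "2 * L"] by (simp add: A_def)
    then have "W x \<le> bW (Kinv aW (2 * L))"
      using W_le[of x] \<sigma>_nonneg[of x] mono_onD[OF bW_mono, of "\<sigma> x" "Kinv aW (2 * L)"] by auto
    moreover have "0 \<le> Kinv aW (2 * L)" using Kinv_nonneg[OF aW] L by simp
    ultimately have \<theta>: "W x + L \<le> \<theta> (r x)" by (simp add: \<theta>_def L_def)
    have q\<theta>: "?q (\<theta> (r x)) = r x / 2"
      by (simp add: q_W_eq Kinv_left[OF class_Kinf_\<theta> r_nonneg])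
    have "?\<rho> (W (F x)) - ?\<rho> (W x) \<le> r x / 2 * L"
    proof (cases "W x \<le> W (F x)")
      case True
      have "?\<rho> (W (F x)) - ?\<rho> (W x) \<le> ?q (W (F x)) * (W (F x) - W x)"
        unfolding rho_W_def using True W_nonneg by (intro integral_class_Kinf_bounds(2)[OF class_Kinf_q_W])
      also have "\<dots> \<le> ?q (\<theta> (r x)) * L"
        using True W' A \<theta> W_nonneg[of "F x"] W_nonneg[of x] L class_Kinf_nonneg[OF class_Kinf_q_W, of "\<theta> (r x)"]
        by (intro mult_mono q_mono) auto
      finally show ?thesis unfolding q\<theta> .
    next
      case False
      then have "?\<rho> (W (F x)) - ?\<rho> (W x) \<le> 0" using \<rho>_mono[of "W (F x)" "W x"] W_nonneg by simp
      moreover have "0 \<le> r x / 2 * L" using r_nonneg[of x] L by simp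
      ultimately show ?thesis by linarith
    qed
    moreover have "?q (A / 4) * (A / 4) \<le> ?q (\<theta> (r x)) * L"
      using False A L \<theta> W_nonneg[of x] class_Kinf_nonneg[OF class_Kinf_q_W, of "\<theta> (r x)"]
      by (intro mult_mono q_mono) auto
    ultimately show ?thesis using V alpha q\<theta> by (simp add: mult.commute)
  qed
qed

text \<open>Since \<open>aW (\<sigma> x) \<le> W x + \<chi>W (v x)\<close>, one summand is at least
  half of the left side; the minimum in \<open>alpha_Y_low\<close> covers both
  possibilities.\<close>

lemma Y_ge: "alpha_Y_low aW \<chi>W bW (\<sigma> x) \<le> rho_V \<chi>W (v x) + rho_W aW \<chi>W bW (W x)"
proof (cases "1/2 * aW (\<sigma> x) \<le> W x")
  case True
  then have "rho_W aW \<chi>W bW (1/2 * aW (\<sigma> x)) \<le> rho_W aW \<chi>W bW (W x)"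
    using class_Kinf_nonneg[OF aW \<sigma>_nonneg] by (intro class_Kinf_mono[OF class_Kinf_rho_W]) auto
  then show ?thesis
    using class_Kinf_nonneg[OF class_Kinf_rho_V v_nonneg, of x] by (simp add: alpha_Y_low_def)
next
  case False
  then have "1/2 * aW (\<sigma> x) \<le> \<chi>W (r x)" using \<chi>W_r_ge[of x] by simp
  also have "\<dots> \<le> \<chi>W (v x)" by (intro class_Kinf_mono[OF \<chi>W] r_le_v r_nonneg)
  finally have "Kinv \<chi>W (1/2 * aW (\<sigma> x)) \<le> v x"
    using class_Kinf_nonneg[OF aW \<sigma>_nonneg] by (subst Kinv_le_iff[OF \<chi>W v_nonneg]) auto
  then have "rho_V \<chi>W (Kinv \<chi>W (1/2 * aW (\<sigma> x))) \<le> rho_V \<chi>W (v x)"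
    using class_Kinf_nonneg[OF aW \<sigma>_nonneg]
    by (intro class_Kinf_mono[OF class_Kinf_rho_V] Kinv_nonneg[OF \<chi>W]) auto
  then show ?thesis
    using class_Kinf_nonneg[OF class_Kinf_rho_W W_nonneg, of x] by (simp add: alpha_Y_low_def)
qed

lemma Y_le: "rho_V \<chi>W (v x) + rho_W aW \<chi>W bW (W x) \<le> alpha_Y_up aW \<chi>W bW bV (\<sigma> x)"
  unfolding alpha_Y_up_def
  by (intro add_mono class_Kinf_mono[OF class_Kinf_rho_V] class_Kinf_mono[OF class_Kinf_rho_W]
      v_nonneg v_le W_nonneg W_le)

lemma class_Kinf_alpha_Y_low: "class_Kinf (alpha_Y_low aW \<chi>W bW)"
proof -
  note half = class_Kinf_compose[OF class_Kinf_linear[of "1/2"] aW]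
  show ?thesis
    unfolding alpha_Y_low_def[abs_def]
    by (rule class_Kinf_min[OF class_Kinf_compose[OF class_Kinf_rho_V
            class_Kinf_compose[OF class_Kinf_Kinv[OF \<chi>W] half]] class_Kinf_compose[OF class_Kinf_rho_W half]])
      simp_all
qed

lemma class_Kinf_alpha_Y_up: "class_Kinf (alpha_Y_up aW \<chi>W bW bV)"
  unfolding alpha_Y_up_def[abs_def]
proof (rule class_Kinf_add[OF class_Kinf_compose[OF class_Kinf_rho_V bV]])
  have bW_nonneg: "0 \<le> bW s" if "0 \<le> s" for s using mono_onD[OF bW_mono, of 0 s] that bW_zero by simp
  show "continuous_on {0..} (\<lambda>s. rho_W aW \<chi>W bW (bW s))"
    using bW_nonneg
    by (intro continuous_on_compose2[OF class_Kinf_continuous[OF class_Kinf_rho_W] bW_cont]) auto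
  show "mono_on {0..} (\<lambda>s. rho_W aW \<chi>W bW (bW s))"
    using bW_nonneg
    by (intro mono_onI class_Kinf_mono[OF class_Kinf_rho_W] mono_onD[OF bW_mono]) auto
qed (simp add: bW_zero class_Kinf_zero[OF class_Kinf_rho_W])

lemma alpha_Y_props:
  "continuous_on {0..} (alpha_Y aW \<chi>W bW)" "alpha_Y aW \<chi>W bW 0 = 0"
  "0 < s \<Longrightarrow> 0 < alpha_Y aW \<chi>W bW s" "mono_on {0..} (alpha_Y aW \<chi>W bW)"
proof -
  note a = class_Kinf_compose[OF class_Kinf_linear[of "1/4"] aW, simplified]
  note qa = class_Kinf_compose[OF class_Kinf_q_W a]
  show "continuous_on {0..} (alpha_Y aW \<chi>W bW)"
    unfolding alpha_Y_def[abs_def]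
    using continuous_on_mult[OF class_Kinf_continuous[OF qa] class_Kinf_continuous[OF a]] by simp
  show "alpha_Y aW \<chi>W bW 0 = 0" by (simp add: alpha_Y_def class_Kinf_zero[OF aW])
  show "0 < alpha_Y aW \<chi>W bW s" if "0 < s"
    using class_Kinf_pos[OF qa that] class_Kinf_pos[OF a that] by (simp add: alpha_Y_def)
  show "mono_on {0..} (alpha_Y aW \<chi>W bW)"
    unfolding alpha_Y_def[abs_def]
    using class_Kinf_mono[OF qa] class_Kinf_mono[OF a] class_Kinf_nonneg[OF qa] class_Kinf_nonneg[OF a]
    by (intro mono_onI mult_mono) auto
qed

text \<open>Otherwise the nonnegative \<open>Y\<close> would fall by the fixed amount
  \<open>d\<close> at every step.\<close>

lemma \<sigma>_arbitrarily_small: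
  assumes "0 < e"
  shows "\<exists>x. \<sigma> x < e"
proof (rule ccontr)
  assume "\<nexists>x. \<sigma> x < e"
  then have e: "e \<le> \<sigma> x" for x by (meson not_le)
  define Y where "Y x = rho_V \<chi>W (v x) + rho_W aW \<chi>W bW (W x)" for x
  define d where "d = alpha_Y aW \<chi>W bW e"
  have d: "0 < d" using alpha_Y_props(3) assms by (simp add: d_def)
  have step: "Y (F x) \<le> Y x - d" for x
    using Y_decrease[of x] mono_onD[OF alpha_Y_props(4), of e "\<sigma> x"] e[of x] assms by (simp add: Y_def d_def)
  have "Y ((F ^^ k) x) \<le> Y x - real k * d" for k x
  proof (induction k)
    case (Suc k)
    then show ?case using step[of "(F ^^ k) x"] by (simp add: algebra_simps)
  qed simp
  moreover have "0 \<le> Y x" for x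
    using class_Kinf_nonneg[OF class_Kinf_rho_V v_nonneg] class_Kinf_nonneg[OF class_Kinf_rho_W W_nonneg]
    by (simp add: Y_def)
  ultimately have "real k * d \<le> Y x" for k x by (meson diff_ge_0_iff_ge order_trans)
  then show False using reals_Archimedean3[OF d] by (meson not_le)
qed

section \<open>The three choices of comparison functions\<close>

context
  assumes \<sigma>_onto: "\<forall>s>0. \<exists>x. \<sigma> x = s"
begin

lemma stability:
  assumes aY: "continuous_on {0..} aY" "aY 0 = 0" "\<And>s. 0 < s \<Longrightarrow> 0 < aY s" "mono_on {0..} aY"
    and low: "class_Kinf low" and up: "class_Kinf up"
    and Y: "\<And>x. Y (F x) \<le> Y x - aY (\<sigma> x)" "\<And>x. low (\<sigma> x) \<le> Y x" "\<And>x. Y x \<le> up (\<sigma> x)"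
  shows "class_KL (decay_bound aY low up)" "\<sigma> ((F ^^ k) x) \<le> decay_bound aY low up (\<sigma> x) k"
proof -
  have Y0: "0 \<le> Y x" for x using Y(2)[of x] class_Kinf_nonneg[OF low \<sigma>_nonneg, of x] by simp
  have "aY (\<sigma> x) \<le> up (\<sigma> x)" for x using Y(1,3)[of x] Y0[of "F x"] by simp
  then have le: "aY s \<le> up s" if "0 \<le> s" for s
    using \<sigma>_onto[rule_format, of s] that aY(2) class_Kinf_zero[OF up] by (cases "s = 0") auto
  show "class_KL (decay_bound aY low up)"
    using aY le low up by (intro class_KL_decay_bound) auto
  show "\<sigma> ((F ^^ k) x) \<le> decay_bound aY low up (\<sigma> x) k"
    using le_decay_bound[of aY up low "\<lambda>k. \<sigma> ((F ^^ k) x)" "\<lambda>k. Y ((F ^^ k) x)" k] aY le low up Y \<sigma>_nonneg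
    by simp
qed

lemma general_case:
  "class_KL (decay_bound (alpha_Y aW \<chi>W bW) (alpha_Y_low aW \<chi>W bW) (alpha_Y_up aW \<chi>W bW bV))"
  "\<sigma> ((F ^^ k) x)
    \<le> decay_bound (alpha_Y aW \<chi>W bW) (alpha_Y_low aW \<chi>W bW) (alpha_Y_up aW \<chi>W bW bV) (\<sigma> x) k"
  "bV (\<sigma> x) - v x \<le> alpha_hat aW \<chi>W bW bV (\<sigma> x)"
proof -
  note Y = alpha_Y_props class_Kinf_alpha_Y_low class_Kinf_alpha_Y_up
    and Y' = Y_decrease Y_ge Y_le
  show "class_KL (decay_bound (alpha_Y aW \<chi>W bW) (alpha_Y_low aW \<chi>W bW) (alpha_Y_up aW \<chi>W bW bV))"
    "\<sigma> ((F ^^ k) x)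
      \<le> decay_bound (alpha_Y aW \<chi>W bW) (alpha_Y_low aW \<chi>W bW) (alpha_Y_up aW \<chi>W bW bV) (\<sigma> x) k"
    by (rule stability[where Y = "\<lambda>x. rho_V \<chi>W (v x) + rho_W aW \<chi>W bW (W x)"]; fact Y Y')+
  \<comment> \<open>The excess of \<open>aW (\<sigma> x)\<close> over \<open>W x\<close> must be
    supplied by the stage cost, and \<open>r x \<le> v x\<close>.\<close>
  have "max 0 (aW (\<sigma> x) - bW (\<sigma> x)) \<le> \<chi>W (v x)"
    using \<chi>W_r_ge[of x] W_le[of x] class_Kinf_mono[OF \<chi>W r_nonneg r_le_v, of x]
      class_Kinf_nonneg[OF \<chi>W v_nonneg, of x] by auto
  then have "Kinv \<chi>W (max 0 (aW (\<sigma> x) - bW (\<sigma> x))) \<le> v x"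
    by (subst Kinv_le_iff[OF \<chi>W v_nonneg]) auto
  then show "bV (\<sigma> x) - v x \<le> alpha_hat aW \<chi>W bW bV (\<sigma> x)" by (simp add: alpha_hat_def)
qed

lemma subidentity_case:
  assumes le: "\<forall>s\<ge>0. \<chi>W s \<le> s"
  shows "class_KL (decay_bound aW aW (\<lambda>s. bV s + bW s))"
    "\<sigma> ((F ^^ k) x) \<le> decay_bound aW aW (\<lambda>s. bV s + bW s) (\<sigma> x) k"
    "bV (\<sigma> x) - v x \<le> min (bV (\<sigma> x)) ((bV (\<sigma> x) + bW (\<sigma> x)) - aW (\<sigma> x))"
proof -
  note aW_props = class_Kinf_continuous[OF aW] class_Kinf_zero[OF aW] class_Kinf_pos[OF aW]
    class_Kinf_mono_on[OF aW] aW class_Kinf_add[OF bV bW_cont bW_mono bW_zero]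
  have step: "v (F x) + W (F x) \<le> v x + W x - aW (\<sigma> x)" for x
    using v_step[of x] W_step[of x] le r_nonneg[of x] by fastforce
  have ge: "aW (\<sigma> x) \<le> v x + W x" for x
    using step[of x] v_nonneg[of "F x"] W_nonneg[of "F x"] by simp
  have up: "v x + W x \<le> bV (\<sigma> x) + bW (\<sigma> x)" for x by (intro add_mono v_le W_le)
  show "class_KL (decay_bound aW aW (\<lambda>s. bV s + bW s))"
    "\<sigma> ((F ^^ k) x) \<le> decay_bound aW aW (\<lambda>s. bV s + bW s) (\<sigma> x) k"
    by (rule stability[where Y = "\<lambda>x. v x + W x"]; fact aW_props step ge up)+
  show "bV (\<sigma> x) - v x \<le> min (bV (\<sigma> x)) ((bV (\<sigma> x) + bW (\<sigma> x)) - aW (\<sigma> x))"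
    using ge[of x] W_le[of x] v_nonneg[of x] by auto
qed

text \<open>Dividing \<open>W\<close> by \<open>c \<ge> cW\<close> brings its supply term below
  \<open>r x\<close>, which the decrease of \<open>v\<close> cancels in
  \<open>v x + W x / c\<close>.\<close>

lemma linear_case:
  assumes "0 < a" "0 \<le> b" and c: "c = max 1 cW"
    and bounds: "\<forall>s\<ge>0. \<chi>W s \<le> cW * s \<and> a * s \<le> aW s \<and> bV s \<le> d * s \<and> bW s \<le> b * s"
  shows "class_KL (linear_decay_bound (a / c) (a / c) (d + b / c))"
    "\<sigma> ((F ^^ k) x) \<le> linear_decay_bound (a / c) (a / c) (d + b / c) (\<sigma> x) k"
    "bV (\<sigma> x) - v x \<le> min d ((d + b / c) - a / c) * \<sigma> x"
proof -
  note le = bounds[rule_format]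
  define Y where "Y x = v x + W x / c" for x
  have c1: "1 \<le> c" "cW \<le> c" using c by auto
  have "\<chi>W (r x) \<le> c * r x" for x
    using le[OF r_nonneg[of x]] mult_right_mono[OF c1(2) r_nonneg[of x]] by simp
  then have "W (F x) - W x \<le> - (a * \<sigma> x) + c * r x" for x
    using W_step[of x] le[OF \<sigma>_nonneg[of x]] by (meson add_mono le_imp_neg_le order_trans)
  then have scaled: "(W (F x) - W x) / c \<le> (- (a * \<sigma> x) + c * r x) / c" for x
    using c1 by (intro divide_right_mono) auto
  have step: "Y (F x) \<le> Y x - a / c * \<sigma> x" for x
    using scaled[of x] v_step[of x] c1 by (simp add: Y_def diff_divide_distrib add_divide_distrib)
  have "0 \<le> Y x" for x using v_nonneg[of x] W_nonneg[of x] c1 by (simp add: Y_def)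
  then have ge: "a / c * \<sigma> x \<le> Y x" for x using step[of x] by (meson diff_ge_0_iff_ge order_trans)
  have Wc: "W x / c \<le> b / c * \<sigma> x" for x
    using W_le[of x] le[OF \<sigma>_nonneg[of x]] c1 by (simp add: divide_right_mono)
  then have up: "Y x \<le> (d + b / c) * \<sigma> x" for x
    using v_le[of x] le[OF \<sigma>_nonneg[of x]] Wc[of x] unfolding Y_def distrib_right by linarith
  \<comment> \<open>At this state the two bounds on \<open>Y z\<close> compare the coefficients
    themselves, so the decay factor is nonnegative.\<close>
  obtain z where "\<sigma> z = 1" using \<sigma>_onto[rule_format, of 1] by auto
  then have a: "0 < a / c" "a / c \<le> d + b / c" using ge[of z] up[of z] assms(1) c1 by auto
  show "class_KL (linear_decay_bound (a / c) (a / c) (d + b / c))"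
    using a by (intro class_KL_linear_decay_bound)
  show "\<sigma> ((F ^^ k) x) \<le> linear_decay_bound (a / c) (a / c) (d + b / c) (\<sigma> x) k"
    using le_linear_decay_bound[OF a a(1), of "\<lambda>k. \<sigma> ((F ^^ k) x)" "\<lambda>k. Y ((F ^^ k) x)" k] step ge up
    by simp
  have "bV (\<sigma> x) - v x \<le> d * \<sigma> x"
    using le[OF \<sigma>_nonneg[of x]] v_nonneg[of x] by simp
  moreover have "bV (\<sigma> x) - v x \<le> ((d + b / c) - a / c) * \<sigma> x"
    using le[OF \<sigma>_nonneg[of x]] ge[of x] Wc[of x] by (simp add: Y_def algebra_simps)
  ultimately show "bV (\<sigma> x) - v x \<le> min d ((d + b / c) - a / c) * \<sigma> x"
    by (simp add: min_def)
qed

end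

end

text \<open>The monotone majorant \<open>B\<close> bounds \<open>g\<close> on each
  \<open>{0..s}\<close>, so the supremum is a genuine least upper bound.\<close>

lemma running_max_props:
  assumes B: "mono_on {0..} B" "\<forall>s\<ge>0. g s \<le> B s"
    and g: "\<forall>s\<ge>0. 0 \<le> g s" "g 0 = 0"
  shows "\<And>s. 0 \<le> s \<Longrightarrow> g s \<le> running_max g s"
    "mono_on {0..} (running_max g)" "running_max g 0 = 0" "\<And>s. 0 \<le> s \<Longrightarrow> 0 \<le> running_max g s"
    "(\<forall>e>0. \<exists>s\<in>{0<..e}. g s \<noteq> 0) \<Longrightarrow> positive_definite (running_max g)"
proof -
  have bdd: "bdd_above (g ` {0..s})" for s
  proof (rule bdd_aboveI2)
    fix t assume "t \<in> {0..s}"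
    then show "g t \<le> B s" using B(2)[rule_format, of t] mono_onD[OF B(1), of t s] by auto
  qed
  have upper: "g t \<le> running_max g s" if "0 \<le> t" "t \<le> s" for s t
    unfolding running_max_def using that by (intro cSUP_upper bdd) auto
  show "g s \<le> running_max g s" if "0 \<le> s" for s using upper that by simp
  show "mono_on {0..} (running_max g)"
    unfolding running_max_def by (intro mono_onI cSUP_subset_mono bdd) auto
  show zero: "running_max g 0 = 0" using g(2) by (simp add: running_max_def)
  show "0 \<le> running_max g s" if "0 \<le> s" for s using upper[of 0 s] that g(2) by simp
  show "positive_definite (running_max g)" if pos: "\<forall>e>0. \<exists>s\<in>{0<..e}. g s \<noteq> 0"
    unfolding positive_definite_def
  proof (intro conjI zero allI impI)
    fix e :: real assume "0 < e"
    then obtain s where "s \<in> {0<..e}" "g s \<noteq> 0" using pos by blast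
    then show "0 < running_max g e" using g(1)[rule_format, of s] upper[of s e] by simp
  qed
qed

text \<open>A compact sublevel set is not the whole space, so values above \<open>s\<close> occur as
  well as values below; connectedness fills in \<open>s\<close>.\<close>

lemma continuous_surj_pos:
  fixes \<sigma> :: "'a::euclidean_space \<Rightarrow> real"
  assumes \<sigma>: "continuous_on UNIV \<sigma>" and compact: "\<And>\<Delta>. \<Delta> > 0 \<Longrightarrow> compact {x. \<sigma> x \<le> \<Delta>}"
    and small: "\<And>e. 0 < e \<Longrightarrow> \<exists>x. \<sigma> x < e" and s: "0 < s"
  shows "\<exists>x. \<sigma> x = s"
proof -
  obtain x where x: "\<sigma> x < s" using small[OF s] by blast
  have "{x. \<sigma> x \<le> s} \<noteq> UNIV" using compact_imp_bounded[OF compact[OF s]] not_bounded_UNIV by metis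
  then obtain y where y: "s < \<sigma> y" by (metis UNIV_eq_I mem_Collect_eq not_le)
  have "connected (range \<sigma>)" by (intro connected_continuous_image \<sigma> connected_UNIV)
  then have "{\<sigma> x..\<sigma> y} \<subseteq> range \<sigma>" by (rule connected_contains_Icc) auto
  moreover have "s \<in> {\<sigma> x..\<sigma> y}" using x y by simp
  ultimately show ?thesis by blast
qed

theorem theorem5:
  fixes f :: "real ^ 'n \<Rightarrow> real ^ 'm \<Rightarrow> real ^ 'n"
    and U :: "real ^ 'n \<Rightarrow> (real ^ 'm) set"
    and l :: "real ^ 'n \<Rightarrow> real ^ 'm \<Rightarrow> real"
    and h0 :: "real ^ 'n \<Rightarrow> real ^ 'm"
    and \<sigma> W :: "real ^ 'n \<Rightarrow> real"
    and aW \<chi>W bW bV :: "real \<Rightarrow> real"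
  assumes U_nonempty: "\<And>x. U x \<noteq> {}"
    and l_nonneg: "\<And>x u. 0 \<le> l x u"
    and \<sigma>: "continuous_on UNIV \<sigma>" "\<And>x. 0 \<le> \<sigma> x"
    and h0: "\<And>x. h0 x \<in> U x"
    \<comment> \<open>(SA1)\<close>
    and SA1: "\<And>x. \<exists>u. admissible f U x u \<and> cost f l x u = Vstar f U l x \<and> cost f l x u < \<infinity>"
    \<comment> \<open>(SA2)\<close>
    and W: "continuous_on UNIV W" "\<And>x. 0 \<le> W x"
    and aW: "class_Kinf aW" and \<chi>W: "class_Kinf \<chi>W"
    and bW: "continuous_on {0..} bW" "mono_on {0..} bW" "bW 0 = 0"
    and SA2_upper: "\<And>x. W x \<le> bW (\<sigma> x)"
    and SA2_decrease: "\<And>x u. u \<in> U x \<Longrightarrow> W (f x u) - W x \<le> - aW (\<sigma> x) + \<chi>W (l x u)"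
    \<comment> \<open>(SA3)\<close>
    and bV: "class_Kinf bV"
    and SA3: "\<And>x. policy_cost f l x h0 \<le> ereal (bV (\<sigma> x))"
    \<comment> \<open>Assumption 2\<close>
    and f_cont: "continuous_on UNIV (\<lambda>(x, u). f x u)"
    and l_cont: "continuous_on UNIV (\<lambda>(x, u). l x u)"
    and l_level: "level_bounded l"
    and U_osc: "outer_semicontinuous U"
    and V0_lsc: "lower_semicontinuous (V_r f U l h0 0)"
    and \<sigma>_compact: "\<And>\<Delta>. \<Delta> > 0 \<Longrightarrow> compact {x. \<sigma> x \<le> \<Delta>}"
  shows
    "(\<forall>hstar. selection (Hstar f U l) hstar \<longrightarrow>
        (\<forall>i x. V_r f U l h0 i x - Vstar f U l x
           \<le> V_r f U l h0 0 (closed_loop f i x hstar) - Vstar f U l (closed_loop f i x hstar))) \<and>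
     (\<forall>ahat \<beta>.
        \<comment> \<open>general case\<close>
        (ahat = alpha_hat aW \<chi>W bW bV \<and>
         \<beta> = decay_bound (alpha_Y aW \<chi>W bW) (alpha_Y_low aW \<chi>W bW) (alpha_Y_up aW \<chi>W bW bV))
        \<comment> \<open>case \<open>\<chi>W \<le> \<I>\<close>\<close>
        \<or> ((\<forall>s\<ge>0. \<chi>W s \<le> s) \<and>
           ahat = (\<lambda>s. min (bV s) ((bV s + bW s) - aW s)) \<and>
           \<beta> = decay_bound aW aW (\<lambda>s. bV s + bW s))
        \<comment> \<open>linear case; \<open>W\<close> is rescaled by \<open>c = max 1 cW\<close>, so \<open>c = 1\<close> if \<open>cW \<le> 1\<close>\<close>
        \<or> (\<exists>cW aW' bV' bW' c. 0 < cW \<and> 0 < aW' \<and> 0 < bV' \<and> 0 \<le> bW' \<and>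
             (\<forall>s\<ge>0. \<chi>W s \<le> cW * s \<and> aW' * s \<le> aW s \<and> bV s \<le> bV' * s \<and> bW s \<le> bW' * s) \<and>
             c = max 1 cW \<and>
             ahat = (\<lambda>s. min bV' ((bV' + bW' / c) - aW' / c) * s) \<and>
             \<beta> = linear_decay_bound (aW' / c) (aW' / c) (bV' + bW' / c))
        \<longrightarrow>
        class_KL \<beta> \<and>
        mono_on {0..} (running_max ahat) \<and>
        running_max ahat 0 = 0 \<and> (\<forall>s\<ge>0. 0 \<le> running_max ahat s) \<and>
        \<comment> \<open>positive definite, unless \<open>ahat\<close> vanishes identically near \<open>0\<close>\<close>
        ((\<forall>e>0. \<exists>s\<in>{0<..e}. ahat s \<noteq> 0) \<longrightarrow> positive_definite (running_max ahat)) \<and>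
        (\<forall>i x. V_r f U l h0 i x - Vstar f U l x \<le> ereal (running_max ahat (\<beta> (\<sigma> x) i))))"
proof -
  interpret pi_plus f l U h0
  proof unfold_locales
    show "policy_cost f l x h0 < \<infinity>" for x
      using SA3[of x] by (rule le_less_trans) simp
  qed (fact l_nonneg f_cont l_cont l_level U_osc h0 SA1 V0_lsc)+
  let ?v = "\<lambda>x. real_of_ereal (Vs x)"
  have Vs: "Vs x = ereal (?v x)" and v_nonneg: "0 \<le> ?v x" for x
    using Vstar_finite[of x] Vstar_nonneg[of l f U x, OF l_nonneg] by (cases "Vs x"; simp)+
  define hs where "hs x = (SOME u. u \<in> Hstar f U l x)" for x
  have hs: "selection (Hstar f U l) hs"
    by (simp add: selection_def hs_def some_in_eq)
  define F where "F x = f x (hs x)" for x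
  have closed_loop_F: "closed_loop f k x hs = (F ^^ k) x" for k x
    by (induction k) (auto simp: F_def)
  interpret detectable_descent F \<sigma> ?v W "\<lambda>x. l x (hs x)" aW \<chi>W bW bV
  proof unfold_locales
    show "?v (F x) = ?v x - l x (hs x)" for x
      using Vstar_hstar[OF hs, of x] Vs[of x] Vs[of "F x"] unfolding F_def
      by (metis add_diff_cancel_left' ereal.inject plus_ereal.simps(1))
    have "Vs x \<le> policy_cost f l x h0" for x by (rule Vstar_le_policy_cost[OF h0])
    then have "Vs x \<le> ereal (bV (\<sigma> x))" for x using SA3 order_trans by blast
    then show "?v x \<le> bV (\<sigma> x)" for x using Vs[of x] by (metis ereal_less_eq(3))
    show "W (F x) - W x \<le> - aW (\<sigma> x) + \<chi>W (l x (hs x))" for x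
      unfolding F_def by (intro SA2_decrease hstar_in_U hs)
  qed (fact \<sigma> l_nonneg v_nonneg W SA2_upper aW \<chi>W bV bW)+
  have \<sigma>_onto: "\<forall>s>0. \<exists>x. \<sigma> x = s"
    by (intro allI impI continuous_surj_pos \<sigma>(1) \<sigma>_compact \<sigma>_arbitrarily_small)

  show ?thesis (is "_ \<and> (\<forall>ahat \<beta>. ?A ahat \<beta> \<longrightarrow> ?C ahat \<beta>)")
  proof (intro conjI)
    show "\<forall>hstar. selection (Hstar f U l) hstar \<longrightarrow>
        (\<forall>i x. V i x - Vs x \<le> V 0 (closed_loop f i x hstar) - Vs (closed_loop f i x hstar))"
      using V_r_minus_Vstar_le by blast
    \<comment> \<open>The argument common to the three cases, which supply the decay bound
      \<open>\<beta>\<close>, the gap bound \<open>g\<close> and a monotone majorant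
      \<open>B\<close> of \<open>g\<close>.\<close>
    have near_optimal: "?C g \<beta>"
      if KL: "class_KL \<beta>" and \<beta>: "\<And>k x. \<sigma> ((F ^^ k) x) \<le> \<beta> (\<sigma> x) k"
        and gap: "\<And>x. bV (\<sigma> x) - ?v x \<le> g (\<sigma> x)" and g0: "g 0 = 0"
        and B: "mono_on {0..} B" "\<forall>s\<ge>0. g s \<le> B s" for g \<beta> B
    proof -
      have "0 \<le> g (\<sigma> x)" for x using gap[of x] v_le[of x] by simp
      then have nonneg: "\<forall>s\<ge>0. 0 \<le> g s"
        using \<sigma>_onto g0 by (metis order_le_less)
      note max = running_max_props[OF B nonneg g0]
      have "V i x - Vs x \<le> ereal (running_max g (\<beta> (\<sigma> x) i))" for i x
      proof -
        let ?y = "(F ^^ i) x"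
        have "V i x - Vs x \<le> V 0 ?y - Vs ?y"
          using V_r_minus_Vstar_le[OF hs, of i x] unfolding closed_loop_F .
        also have "\<dots> \<le> ereal (bV (\<sigma> ?y)) - ereal (?v ?y)"
          unfolding Vs[symmetric] using SA3[of ?y] by (intro ereal_minus_mono) auto
        also have "\<dots> \<le> ereal (g (\<sigma> ?y))" using gap[of ?y] by simp
        also have "\<dots> \<le> ereal (running_max g (\<sigma> ?y))" using max(1)[OF \<sigma>(2)] by simp
        also have "\<dots> \<le> ereal (running_max g (\<beta> (\<sigma> x) i))"
          using mono_onD[OF max(2), of "\<sigma> ?y" "\<beta> (\<sigma> x) i"] \<beta>[of i x] \<sigma>(2)[of ?y] by simp
        finally show ?thesis .
      qed
      then show ?thesis using KL max(2-5) by blast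
    qed
    show "\<forall>ahat \<beta>. ?A ahat \<beta> \<longrightarrow> ?C ahat \<beta>"
    proof (intro allI impI, elim disjE exE conjE)
      fix ahat \<beta>
      assume eq: "ahat = alpha_hat aW \<chi>W bW bV"
        "\<beta> = decay_bound (alpha_Y aW \<chi>W bW) (alpha_Y_low aW \<chi>W bW) (alpha_Y_up aW \<chi>W bW bV)"
      show "?C ahat \<beta>"
        unfolding eq
      \<comment> \<open>The subtracted inverse is nonnegative, so \<open>bV\<close> serves as the
        majorant.\<close>
      proof (rule near_optimal[OF general_case[OF \<sigma>_onto] _ class_Kinf_mono_on[OF bV]])
        show "alpha_hat aW \<chi>W bW bV 0 = 0"
          using class_Kinf_zero[OF aW] class_Kinf_zero[OF bV] class_Kinf_zero[OF class_Kinf_Kinv[OF \<chi>W]]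
          by (simp add: alpha_hat_def bW(3))
        show "\<forall>s\<ge>0. alpha_hat aW \<chi>W bW bV s \<le> bV s"
          using Kinv_nonneg[OF \<chi>W] by (simp add: alpha_hat_def)
      qed
    next
      fix ahat \<beta>
      assume le: "\<forall>s\<ge>0. \<chi>W s \<le> s" and eq: "ahat = (\<lambda>s. min (bV s) ((bV s + bW s) - aW s))"
        "\<beta> = decay_bound aW aW (\<lambda>s. bV s + bW s)"
      show "?C ahat \<beta>"
        unfolding eq
      proof (rule near_optimal[OF subidentity_case[OF \<sigma>_onto le] _ class_Kinf_mono_on[OF bV]])
        show "min (bV 0) (bV 0 + bW 0 - aW 0) = 0"
          using class_Kinf_zero[OF aW] class_Kinf_zero[OF bV] by (simp add: bW(3))
      qed simp
    next
      fix ahat \<beta> and cW aW' bV' bW' c :: real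
      assume pos: "0 < aW'" "0 \<le> bW'" "0 < bV'" and c: "c = max 1 cW"
        and le: "\<forall>s\<ge>0. \<chi>W s \<le> cW * s \<and> aW' * s \<le> aW s \<and> bV s \<le> bV' * s \<and> bW s \<le> bW' * s"
        and eq: "ahat = (\<lambda>s. min bV' ((bV' + bW' / c) - aW' / c) * s)"
          "\<beta> = linear_decay_bound (aW' / c) (aW' / c) (bV' + bW' / c)"
      note lin = linear_case[OF \<sigma>_onto pos(1,2) c le]
      show "?C ahat \<beta>"
        unfolding eq
      proof (rule near_optimal[OF lin])
        show "mono_on {0..} (\<lambda>s. bV' * s)"
          using pos by (intro mono_onI mult_left_mono) auto
      qed (auto intro: mult_right_mono)
    qed
  qed
qed

end
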